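(* Let $d\ge1$, and for $i\in\{1,2\}$ let $\mu_i\in\mathbb{R}^d$ and let $\Sigma_i$ be a real symmetric positive-definite $d\times d$ matrix. Let $\theta_i=\left(\Sigma_i^{-1}\mu_i,\frac12\Sigma_i^{-1}\right)$, $\eta_i=\nabla F_{\mathcal{N}}(\theta_i)$, $\bar P_i=f(\mu_i,\Sigma_i)$, $\bar\theta_i=\frac12\bar P_i^{-1}$ and $\bar\eta_i=\nabla F_{\mathcal{P}}(\bar\theta_i)$. Then $$D_{\mathrm{KL}}[p_{\mu_1,\Sigma_1}:p_{\mu_2,\Sigma_2}]=B_{F_{\mathcal{N}}}(\theta_2:\theta_1)=Y_{F_{\mathcal{N}}}(\theta_2:\eta_1)=Y_{F_{\mathcal{P}}}(\bar\theta_2:\bar\eta_1)=B_{F_{\mathcal{P}}}(\bar\theta_2:\bar\theta_1)=D_{\mathrm{KL}}[p_{0,\bar P_1}:p_{0,\bar P_2}].$$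
   Context: For $\mu\in\mathbb{R}^k$ and $\Sigma$ symmetric positive-definite of size $k\times k$, $p_{\mu,\Sigma}$ denotes the density on $\mathbb{R}^k$ of the $k$-variate normal distribution with mean $\mu$ and covariance matrix $\Sigma$, and $D_{\mathrm{KL}}[p:q]=\int p\log(p/q)\,dx$ is the Kullback-Leibler divergence. Define $$f(\mu,\Sigma)=\begin{bmatrix}\Sigma+\mu\mu^\top&\mu\\ \mu^\top&1\end{bmatrix},$$ a symmetric positive-definite $(d+1)\times(d+1)$ matrix. Parameters $\theta=(\theta_v,\theta_M)$ consist of a vector $\theta_v\in\mathbb{R}^d$ and a symmetric positive-definite $d\times d$ matrix $\theta_M$. The inner product is $\langle(v_1,M_1),(v_2,M_2)\rangle=v_1^\top v_2+\operatorname{tr}(M_1M_2^\top)$, and gradients are taken with respect to it (on vectors $\times$ symmetric matrices). The natural parameter of $N(\mu,\Sigma)$, for the sufficient statistic $(x,-xx^\top)$, is $\theta=(\Sigma^{-1}\mu,\frac12\Sigma^{-1})$, and the log-normalizer is $$F_{\mathcal{N}}(\theta)=\tfrac12\left(d\log\pi-\log|\theta_M|+\tfrac12\theta_v^\top\theta_M^{-1}\theta_v\right),$$ where $|\cdot|$ denotes the determinant. With $\eta=\nabla F_{\mathcal{N}}(\theta)$, the moment parameter of $N(\mu,\Sigma)$ is $\eta=(\mu,-\Sigma-\mu\mu^\top)$. For centered $(d+1)$-variate normal distributions the log-normalizer is $F_{\mathcal{P}}(P)=F_{\mathcal{N}}(0,P)$ with $d$ replaced by $d+1$, i.e. $F_{\mathcal{P}}(P)=\frac12\left((d+1)\log\pi-\log|P|\right)$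 for $P$ symmetric positive-definite of size $(d+1)\times(d+1)$, with inner product $\operatorname{tr}(M_1M_2^\top)$. For a strictly convex differentiable $F$: the Bregman divergence is $B_F(\theta:\theta')=F(\theta)-F(\theta')-\langle\theta-\theta',\nabla F(\theta')\rangle$; the Legendre convex conjugate is $F^*(\eta)=\langle\theta,\eta\rangle-F(\theta)$ for $\eta=\nabla F(\theta)$; the Fenchel-Young divergence is $Y_F(\theta:\eta')=F(\theta)+F^*(\eta')-\langle\theta,\eta'\rangle$. *)

theory Defs
  imports "HOL-Probability.Probability"
begin

definition sym_matrices :: "(real^'n^'n) set" where
  "sym_matrices = {M. transpose M = M}"

definition spd_matrices :: "(real^'n^'n) set" where
  "spd_matrices = {M. transpose M = M \<and> (\<forall>x. x \<noteq> 0 \<longrightarrow> x \<bullet> (M *v x) > 0)}"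

definition mvn_density :: "real^'n \<Rightarrow> real^'n^'n \<Rightarrow> real^'n \<Rightarrow> real" where
  "mvn_density \<mu> \<Sigma> x =
     exp (- (1/2) * ((x - \<mu>) \<bullet> (matrix_inv \<Sigma> *v (x - \<mu>)))) / sqrt ((2 * pi) ^ CARD('n) * det \<Sigma>)"

definition kl_div :: "('a::euclidean_space \<Rightarrow> real) \<Rightarrow> ('a \<Rightarrow> real) \<Rightarrow> real" where
  "kl_div p q = (\<integral>x. p x * ln (p x / q x) \<partial>lborel)"

text \<open>For positive densities this is the library's divergence, whose arguments come in the
  opposite order, to base \<open>e\<close>.\<close>

lemma kl_div_eq_KL_divergence:
  assumes "p \<in> borel_measurable lborel" "q \<in> borel_measurable lborel"
    and "\<And>x. p x > 0" "\<And>x. q x > 0"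
  shows "kl_div p q = KL_divergence (exp 1) (density lborel q) (density lborel p)"
proof -
  have "KL_divergence (exp 1) (density lborel (\<lambda>x. ennreal (q x))) (density lborel (\<lambda>x. ennreal (p x)))
      = (\<integral>x. p x * log (exp 1) (p x / q x) \<partial>lborel)"
    using assms
    by (intro lborel.KL_density_density) (auto simp: less_imp_le order_less_imp_not_eq2)
  then show ?thesis
    by (simp add: kl_div_def log_def)
qed

text \<open>The \<open>Some\<close> indices are the first \<open>d\<close> coordinates of the \<open>(d+1)\<close>-dimensional space, \<open>None\<close> is
  the last one.\<close>

definition block_embed :: "real^('n::finite) \<Rightarrow> real^'n^'n \<Rightarrow> real^('n option)^('n option)" where
  "block_embed \<mu> \<Sigma> = (\<chi> i j.
     case (i, j) of
       (Some a, Some b) \<Rightarrow> \<Sigma> $ a $ b + \<mu> $ a * \<mu> $ b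
     | (Some a, None) \<Rightarrow> \<mu> $ a
     | (None, Some b) \<Rightarrow> \<mu> $ b
     | (None, None) \<Rightarrow> 1)"

text \<open>The inner product of the types \<open>real^'n^'n\<close> and \<open>(real^'n) \<times> (real^'n^'n)\<close> is the one used for
  the parameters.\<close>

lemma inner_matrix_eq_trace: "M1 \<bullet> M2 = trace (M1 ** transpose M2)" for M1 M2 :: "real^'n^'n"
  by (simp add: inner_vec_def trace_def matrix_matrix_mult_def transpose_def)

lemma inner_param_eq:
  "(v1, M1) \<bullet> (v2, M2) = v1 \<bullet> v2 + trace (M1 ** transpose M2)" for M1 M2 :: "real^'n^'n"
  by (simp add: inner_matrix_eq_trace)

text \<open>Gradient of a function on the linear subspace \<open>V\<close>. Taking the derivative within \<open>V\<close> and the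
  representing vector in \<open>V\<close> makes it unique, and independent of the values of \<open>F\<close> outside \<open>V\<close>.\<close>

definition gradient_on :: "'a::real_inner set \<Rightarrow> ('a \<Rightarrow> real) \<Rightarrow> 'a \<Rightarrow> 'a" where
  "gradient_on V F \<theta> = (THE g. g \<in> V \<and> (F has_derivative (\<lambda>h. g \<bullet> h)) (at \<theta> within V))"

definition bregman_div :: "'a::real_inner set \<Rightarrow> ('a \<Rightarrow> real) \<Rightarrow> 'a \<Rightarrow> 'a \<Rightarrow> real" where
  "bregman_div V F \<theta> \<theta>' = F \<theta> - F \<theta>' - (\<theta> - \<theta>') \<bullet> gradient_on V F \<theta>'"

text \<open>In the following, \<open>\<Theta> \<subseteq> V\<close> is the parameter domain of \<open>F\<close>, a relatively open subset of \<open>V\<close>.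
  Strict convexity of \<open>F\<close> on \<open>\<Theta>\<close> makes the parameter with gradient \<open>\<eta>\<close> unique.\<close>

definition legendre_conj :: "'a::real_inner set \<Rightarrow> 'a set \<Rightarrow> ('a \<Rightarrow> real) \<Rightarrow> 'a \<Rightarrow> real" where
  "legendre_conj \<Theta> V F \<eta> =
     (let \<theta> = (THE \<theta>. \<theta> \<in> \<Theta> \<and> gradient_on V F \<theta> = \<eta>) in \<theta> \<bullet> \<eta> - F \<theta>)"

definition fenchel_young_div ::
  "'a::real_inner set \<Rightarrow> 'a set \<Rightarrow> ('a \<Rightarrow> real) \<Rightarrow> 'a \<Rightarrow> 'a \<Rightarrow> real" where
  "fenchel_young_div \<Theta> V F \<theta> \<eta>' = F \<theta> + legendre_conj \<Theta> V F \<eta>' - \<theta> \<bullet> \<eta>'"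

definition F_N :: "(real^'n) \<times> (real^'n^'n) \<Rightarrow> real" where
  "F_N = (\<lambda>(\<theta>v, \<theta>M).
     1/2 * (real CARD('n) * ln pi - ln (det \<theta>M) + 1/2 * (\<theta>v \<bullet> (matrix_inv \<theta>M *v \<theta>v))))"

definition F_P :: "real^'m^'m \<Rightarrow> real" where
  "F_P P = F_N (0, P)"

lemma F_P_eq:
  "F_P (P :: real^('n::finite option)^('n option)) = 1/2 * ((real CARD('n) + 1) * ln pi - ln (det P))"
  by (simp add: F_P_def F_N_def)

definition natural_param :: "real^'n \<Rightarrow> real^'n^'n \<Rightarrow> (real^'n) \<times> (real^'n^'n)" where
  "natural_param \<mu> \<Sigma> = (matrix_inv \<Sigma> *v \<mu>, (1/2) *\<^sub>R matrix_inv \<Sigma>)"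

abbreviation space_N :: "((real^'n) \<times> (real^'n^'n)) set" where
  "space_N \<equiv> UNIV \<times> sym_matrices"

abbreviation domain_N :: "((real^'n) \<times> (real^'n^'n)) set" where
  "domain_N \<equiv> UNIV \<times> spd_matrices"

end

theory Submission
  imports Defs
begin

text \<open>Writing \<open>\<Sigma> = A A\<^sup>T\<close>, the substitution \<open>x = \<mu> + A y\<close> turns the Kullback-Leibler integral into the
  expectation of a quadratic polynomial under the standard normal distribution, which gives
  \<open>2 KL = ln (det \<Sigma>\<^sub>2 / det \<Sigma>\<^sub>1) - d + tr (\<Sigma>\<^sub>2\<inverse> \<Sigma>\<^sub>1) + (\<mu>\<^sub>1 - \<mu>\<^sub>2)\<^sup>T \<Sigma>\<^sub>2\<inverse> (\<mu>\<^sub>1 - \<mu>\<^sub>2)\<close>.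
  The gradient of \<open>F_N\<close> at the natural parameter is the moment parameter, and so the Bregman divergence
  has the same closed form; since the gradient map is injective, the Fenchel-Young divergence is the
  Bregman divergence. The centered case is the same computation in dimension \<open>d + 1\<close>, and the two
  closed forms agree because the embedded matrix \<open>P\<close> has the determinant of \<open>\<Sigma>\<close> and because
  \<open>tr (P\<^sub>2\<inverse> P\<^sub>1)\<close> absorbs the quadratic form in \<open>\<mu>\<^sub>1 - \<mu>\<^sub>2\<close> up to the constant \<open>1\<close>.\<close>

section \<open>Symmetric positive-definite matrices\<close>

definition outer :: "real^'n \<Rightarrow> real^'m \<Rightarrow> real^'m^'n" where
  "outer v w = (\<chi> i j. v $ i * w $ j)"

lemma outer_mult_vec: "outer v w *v x = (w \<bullet> x) *\<^sub>R v"
  by (simp add: outer_def matrix_vector_mult_def vec_eq_iff inner_vec_def sum_distrib_left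
      sum_distrib_right mult_ac)

lemma inner_outer: "A \<bullet> outer v w = v \<bullet> (A *v w)"
  by (simp add: outer_def matrix_vector_mult_def inner_vec_def sum_distrib_left mult_ac)

lemma transpose_outer: "transpose (outer v w) = outer w v"
  by (simp add: outer_def transpose_def vec_eq_iff mult.commute)

lemma trace_mult_eq_inner: "transpose B = B \<Longrightarrow> trace (A ** B) = A \<bullet> B" for A B :: "real^'n^'n"
  by (metis inner_matrix_eq_trace)

lemma inner_matvec_transpose: "x \<bullet> (A *v y) = (transpose A *v x) \<bullet> y" for A :: "real^'n^'m"
  by (simp add: dot_lmul_matrix)

section \<open>Inverses of square matrices\<close>

lemma matrix_inv_mult:
  assumes "invertible A"
  shows "A ** matrix_inv A = mat 1" "matrix_inv A ** A = mat 1"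
  using someI_ex[OF assms[unfolded invertible_def]] by (auto simp: matrix_inv_def)

lemma matrix_inv_unique:
  fixes A B :: "real^'n^'n"
  assumes "A ** B = mat 1"
  shows "matrix_inv A = B" "invertible A" "invertible B"
proof -
  have BA: "B ** A = mat 1" using assms matrix_left_right_inverse by blast
  show inv: "invertible A" "invertible B" using assms BA by (auto simp: invertible_def)
  have "matrix_inv A = (matrix_inv A ** A) ** B"
    by (metis assms matrix_mul_assoc matrix_mul_rid)
  then show "matrix_inv A = B" by (simp add: matrix_inv_mult inv)
qed

lemma matrix_inv_inv: "invertible A \<Longrightarrow> matrix_inv (matrix_inv A) = A" for A :: "real^'n^'n"
  by (rule matrix_inv_unique(1)) (simp add: matrix_inv_mult)

lemma invertible_matrix_inv: "invertible A \<Longrightarrow> invertible (matrix_inv A)" for A :: "real^'n^'n"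
  using matrix_inv_mult matrix_inv_unique(2) by blast

lemma matrix_inv_vec:
  fixes A :: "real^'n^'n"
  assumes "invertible A"
  shows "A *v (matrix_inv A *v x) = x" "matrix_inv A *v (A *v x) = x"
  by (simp_all add: matrix_vector_mul_assoc matrix_inv_mult assms)

lemma det_matrix_inv:
  fixes A :: "real^'n^'n"
  assumes "invertible A"
  shows "det (matrix_inv A) = 1 / det A"
proof -
  have "det A * det (matrix_inv A) = 1"
    by (metis assms det_I det_mul matrix_inv_mult(1))
  then show ?thesis by (metis nonzero_eq_divide_eq mult.commute mult_zero_left zero_neq_one)
qed

lemma matrix_inv_scaleR:
  fixes A :: "real^'n^'n"
  assumes "invertible A" "c \<noteq> 0"
  shows "matrix_inv (c *\<^sub>R A) = (1/c) *\<^sub>R matrix_inv A"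
  by (rule matrix_inv_unique(1)) (simp add: matrix_scalar_ac scalar_matrix_assoc [symmetric] assms matrix_inv_mult)

lemma det_scaleR: "det (c *\<^sub>R A) = c ^ CARD('n) * det A" for A :: "real^'n^'n"
proof -
  have "c *\<^sub>R A = (\<chi> i. c *s A $ i)" by (simp add: vec_eq_iff)
  then show ?thesis by (simp add: det_rows_mul)
qed

lemma transpose_matrix_inv:
  fixes A :: "real^'n^'n"
  assumes "invertible A"
  shows "transpose (matrix_inv A) = matrix_inv (transpose A)"
proof -
  have "transpose A ** transpose (matrix_inv A) = mat 1"
    by (metis assms matrix_inv_mult(2) matrix_transpose_mul transpose_mat)
  then show ?thesis using matrix_inv_unique(1) by metis
qed

section \<open>Positive-definite matrices and their factorization\<close>

lemma subspace_sym_matrices: "subspace sym_matrices"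
  by (auto simp: subspace_def sym_matrices_def transpose_def vec_eq_iff)

lemma spd_imp_sym: "M \<in> spd_matrices \<Longrightarrow> M \<in> sym_matrices"
  by (simp add: spd_matrices_def sym_matrices_def)

text \<open>Gram-Schmidt for the form given by \<open>M\<close>. The vectors are indexed by a subset
  of the index type itself, so that at \<open>S = UNIV\<close> they become the rows of a square
  matrix. A proper subset gives fewer vectors than the dimension, which leaves room for one more
  direction.\<close>

lemma spd_orthonormal_vectors:
  fixes M :: "real^'n^'n"
  assumes M: "M \<in> spd_matrices" and "finite S"
  shows "\<exists>b :: 'n \<Rightarrow> real^'n. \<forall>i\<in>S. \<forall>j\<in>S. b i \<bullet> (M *v b j) = of_bool (i = j)"
  using \<open>finite S\<close>
proof (induction S rule: finite_induct)
  case empty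
  then show ?case by simp
next
  case (insert k S)
  then obtain b :: "'n \<Rightarrow> real^'n"
    where b: "\<And>i j. i \<in> S \<Longrightarrow> j \<in> S \<Longrightarrow> b i \<bullet> (M *v b j) = of_bool (i = j)" by blast
  let ?T = "(\<lambda>i. M *v b i) ` S"
  have "card (insert k S) \<le> CARD('n)" by (rule card_mono) auto
  then have "card S < DIM(real^'n)" using insert by simp
  moreover have "dim ?T \<le> card S"
    by (meson card_image_le dim_le_card' finite_imageI insert.hyps(1) le_trans)
  ultimately obtain x where x: "x \<noteq> 0" "\<And>y. y \<in> span ?T \<Longrightarrow> orthogonal x y"
    using orthogonal_to_subspace_exists[of ?T] by auto
  have sym: "u \<bullet> (M *v v) = v \<bullet> (M *v u)" for u v
    using M inner_matvec_transpose[of u M v] by (simp add: spd_matrices_def inner_commute)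
  have xb: "x \<bullet> (M *v b i) = 0" if "i \<in> S" for i
    using x(2)[OF span_base] that by (auto simp: orthogonal_def)
  have pos: "x \<bullet> (M *v x) > 0" using M x(1) by (simp add: spd_matrices_def)
  define y where "y = (1 / sqrt (x \<bullet> (M *v x))) *\<^sub>R x"
  have yy: "y \<bullet> (M *v y) = 1"
    using pos by (simp add: y_def matrix_vector_mult_scaleR)
  have yb: "y \<bullet> (M *v b i) = 0" "b i \<bullet> (M *v y) = 0" if "i \<in> S" for i
    using xb[OF that] sym[of "b i" y] by (simp_all add: y_def)
  have "\<forall>i\<in>insert k S. \<forall>j\<in>insert k S. (b(k := y)) i \<bullet> (M *v (b(k := y)) j) = of_bool (i = j)"
    using insert.hyps(2) b yy yb by auto
  then show ?case by blast
qed

text \<open>If the rows of \<open>B\<close> are orthonormal for \<open>M\<close>, then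
  \<open>B ** M ** transpose B\<close> is the identity, so \<open>A = M ** transpose B\<close> is
  the inverse of \<open>B\<close>, and \<open>A ** transpose A = A ** B ** M = M\<close>. The
  determinant, the change of variables and the block embedding all use this factor.\<close>

lemma spd_factorization:
  fixes M :: "real^'n^'n"
  assumes "M \<in> spd_matrices"
  obtains A :: "real^'n^'n" where "invertible A" "M = A ** transpose A"
proof -
  obtain b :: "'n \<Rightarrow> real^'n" where b: "\<And>i j. b i \<bullet> (M *v b j) = of_bool (i = j)"
    using spd_orthonormal_vectors[OF assms finite_class.finite_UNIV] by auto
  define B where "B = (\<chi> i. b i)"
  have entry: "(B ** (M ** transpose B)) $ i $ j = b i \<bullet> (M *v b j)" for i j
    by (simp add: B_def matrix_matrix_mult_def matrix_vector_mult_def transpose_def inner_vec_def)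
  have 1: "B ** (M ** transpose B) = mat 1"
    by (simp add: vec_eq_iff entry b mat_def)
  then have 2: "(M ** transpose B) ** B = mat 1"
    using matrix_left_right_inverse by blast
  have "(M ** transpose B) ** transpose (M ** transpose B) = (M ** transpose B) ** B ** M"
    using assms by (simp add: matrix_transpose_mul spd_matrices_def matrix_mul_assoc)
  also have "\<dots> = M" by (simp add: 2)
  finally show ?thesis using that matrix_inv_unique(2)[OF 2] by metis
qed

lemma spd_det_pos:
  fixes M :: "real^'n^'n"
  assumes "M \<in> spd_matrices"
  shows "det M > 0"
proof -
  obtain A :: "real^'n^'n" where A: "invertible A" "M = A ** transpose A"
    using spd_factorization[OF assms] by blast
  then have "det M = (det A)\<^sup>2" by (simp add: det_mul power2_eq_square)
  then show ?thesis using A(1) by (simp add: invertible_det_nz)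
qed

lemma spd_invertible: "M \<in> spd_matrices \<Longrightarrow> invertible M" for M :: "real^'n^'n"
  using spd_det_pos[of M] by (simp add: invertible_det_nz)

lemma sym_matrix_inv:
  "M \<in> spd_matrices \<Longrightarrow> transpose (matrix_inv M) = matrix_inv M"
  by (simp add: transpose_matrix_inv spd_invertible) (simp add: spd_matrices_def)

lemma spd_matrix_inv:
  assumes "M \<in> spd_matrices"
  shows "matrix_inv M \<in> spd_matrices"
proof -
  have inv: "invertible M" using assms by (rule spd_invertible)
  have "x \<bullet> (matrix_inv M *v x) > 0" if "x \<noteq> 0" for x
  proof -
    let ?y = "matrix_inv M *v x"
    have "?y \<noteq> 0" using that inv by (metis matrix_inv_vec(1) matrix_vector_mult_0_right)
    then have "?y \<bullet> (M *v ?y) > 0" using assms by (simp add: spd_matrices_def)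
    then show ?thesis by (simp add: matrix_inv_vec inv inner_commute)
  qed
  then show ?thesis using sym_matrix_inv[OF assms] by (simp add: spd_matrices_def)
qed

lemma spd_scaleR: "M \<in> spd_matrices \<Longrightarrow> c > 0 \<Longrightarrow> c *\<^sub>R M \<in> spd_matrices"
  by (simp add: spd_matrices_def transpose_scalar scaleR_matrix_vector_assoc [symmetric])

section \<open>Lebesgue measure under linear maps\<close>

lemma prod_Basis_cart: "(\<Prod>b\<in>Basis. f b) = (\<Prod>i\<in>UNIV. f (axis i (1::real) :: real^'n))"
proof -
  have "Basis = range (\<lambda>i. axis i (1::real) :: real^'n)"
    by (auto simp: Basis_vec_def)
  then have "prod f Basis = prod f (range (\<lambda>i. axis i 1))"
    by (rule arg_cong)
  also have "\<dots> = (\<Prod>i\<in>UNIV. f (axis i 1))"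
    by (subst prod.reindex) (auto simp: inj_on_def axis_eq_axis)
  finally show ?thesis .
qed

lemma measurable_vec_lambda [measurable]:
  "(\<lambda>f. \<chi> i. f i) \<in> (\<Pi>\<^sub>M i\<in>UNIV. lborel) \<rightarrow>\<^sub>M (borel :: (real^'n) measure)"
proof -
  have "(\<lambda>f. \<Sum>i\<in>UNIV. f i *\<^sub>R axis i (1::real)) \<in> (\<Pi>\<^sub>M i\<in>UNIV. lborel) \<rightarrow>\<^sub>M (borel :: (real^'n) measure)"
    by measurable
  also have "(\<lambda>f. \<Sum>i\<in>UNIV. f i *\<^sub>R axis i (1::real)) = (\<lambda>f. (\<chi> i. f i) :: real^'n)"
    by (auto simp: fun_eq_iff vec_eq_iff axis_def if_distrib cong: if_cong)
  finally show ?thesis .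
qed

text \<open>Both measures give a box the product of its side lengths. This makes Fubini available
  coordinate by coordinate.\<close>

lemma lborel_cart_eq_PiM:
  "(lborel :: (real^'n) measure) = distr (\<Pi>\<^sub>M i\<in>UNIV. lborel) borel (\<lambda>f. \<chi> i. f i)"
proof (rule lborel_eqI)
  fix l u :: "real^'n"
  assume le: "\<And>b. b \<in> Basis \<Longrightarrow> l \<bullet> b \<le> u \<bullet> b"
  then have le: "l $ i \<le> u $ i" for i
    by (metis axis_in_Basis_iff cart_eq_inner_axis insertI1 Basis_real_def)
  interpret product_sigma_finite "\<lambda>_::'n. lborel :: real measure"
    by (simp add: lborel.sigma_finite_measure_axioms product_sigma_finite.intro)
  have eq: "(\<lambda>f. (\<chi> i. f i) :: real^'n) -` box l u \<inter> space (\<Pi>\<^sub>M i\<in>UNIV. lborel)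
    = (\<Pi>\<^sub>E i\<in>UNIV. {l $ i <..< u $ i})"
    by (auto simp: mem_box_cart space_PiM PiE_def Pi_iff)
  have "emeasure (distr (\<Pi>\<^sub>M i\<in>UNIV. lborel) borel (\<lambda>f. \<chi> i. f i)) (box l u)
      = (\<Prod>i\<in>UNIV. ennreal (u $ i - l $ i))"
    by (simp add: emeasure_distr eq emeasure_PiM le)
  also have "\<dots> = (\<Prod>b\<in>Basis. (u - l) \<bullet> b)"
    by (simp add: prod_ennreal le prod_Basis_cart inner_axis)
  finally show "emeasure (distr (\<Pi>\<^sub>M i\<in>UNIV. lborel) borel (\<lambda>f. \<chi> i. f i)) (box l u)
      = (\<Prod>b\<in>Basis. (u - l) \<bullet> b)" .
qed simp

lemma has_bochner_integral_prod_cart: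
  fixes g :: "'n::finite \<Rightarrow> real \<Rightarrow> real"
  assumes "\<And>i. has_bochner_integral lborel (g i) (I i)"
  shows "has_bochner_integral (lborel :: (real^'n) measure) (\<lambda>x. \<Prod>i\<in>UNIV. g i (x $ i)) (\<Prod>i\<in>UNIV. I i)"
proof -
  interpret product_sigma_finite "\<lambda>_::'n. lborel :: real measure"
    by (simp add: lborel.sigma_finite_measure_axioms product_sigma_finite.intro)
  have [measurable]: "g i \<in> borel_measurable borel" for i
    using assms[of i] by (auto simp: has_bochner_integral_iff)
  have int: "integrable lborel (g i)" "integral\<^sup>L lborel (g i) = I i" for i
    using assms[of i] by (auto simp: has_bochner_integral_iff)
  show ?thesis
    unfolding lborel_cart_eq_PiM
    by (rule has_bochner_integral_distr)
       (auto simp: has_bochner_integral_iff int intro!: product_integrable_prod product_integral_prod[THEN trans])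
qed

lemma measurable_matrix_vector [measurable]: "(\<lambda>x. A *v x) \<in> borel \<rightarrow>\<^sub>M borel"
  for A :: "real^'n^'m"
  by (intro borel_measurable_continuous_onI linear_continuous_on)
     (simp add: linear_linear)

text \<open>Integrate over coordinate \<open>m\<close> first: with the other coordinates fixed, the
  shear is a translation by \<open>y n\<close>, which the inner one-dimensional integral does not
  see.\<close>

lemma nn_integral_shear:
  fixes f :: "real^'n \<Rightarrow> ennreal"
  assumes [measurable]: "f \<in> borel_measurable borel" and mn: "m \<noteq> n"
  shows "(\<integral>\<^sup>+x. f (\<chi> i. if i = m then x $ m + x $ n else x $ i) \<partial>lborel) = (\<integral>\<^sup>+x. f x \<partial>lborel)"
proof -
  interpret product_sigma_finite "\<lambda>_::'n. lborel :: real measure"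
    by (simp add: lborel.sigma_finite_measure_axioms product_sigma_finite.intro)
  let ?M = "\<lambda>J. \<Pi>\<^sub>M i\<in>J. (lborel :: real measure)"
  let ?T = "\<lambda>x. (\<chi> i. if i = m then x $ m + x $ n else x $ i) :: real^'n"
  have "continuous_on UNIV (\<lambda>x :: real^'n. if i = m then x $ m + x $ n else x $ i)" for i
    by (cases "i = m") (auto intro!: continuous_intros)
  then have [measurable]: "?T \<in> borel \<rightarrow>\<^sub>M borel"
    by (intro borel_measurable_continuous_onI continuous_on_vec_lambda)
  have split: "(\<integral>\<^sup>+x. h x \<partial>lborel) = (\<integral>\<^sup>+y. \<integral>\<^sup>+t. h (\<chi> i. (y(m := t)) i) \<partial>lborel \<partial>?M (UNIV - {m}))"
    if [measurable]: "h \<in> borel_measurable borel" for h :: "real^'n \<Rightarrow> ennreal"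
  proof -
    have "(\<integral>\<^sup>+x. h x \<partial>lborel) = (\<integral>\<^sup>+y. h (\<chi> i. y i) \<partial>?M UNIV)"
      by (simp add: lborel_cart_eq_PiM nn_integral_distr)
    also have "\<dots> = (\<integral>\<^sup>+y. h (\<chi> i. y i) \<partial>?M (insert m (UNIV - {m})))"
      by (simp add: insert_absorb)
    also have "\<dots> = (\<integral>\<^sup>+y. \<integral>\<^sup>+t. h (\<chi> i. (y(m := t)) i) \<partial>lborel \<partial>?M (UNIV - {m}))"
    proof (rule product_nn_integral_insert)
      show "(\<lambda>y. h (\<chi> i. y i)) \<in> borel_measurable (?M (insert m (UNIV - {m})))"
        by (simp add: insert_absorb)
    qed auto
    finally show ?thesis .
  qed
  have "(\<integral>\<^sup>+x. f (?T x) \<partial>lborel)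
      = (\<integral>\<^sup>+y. \<integral>\<^sup>+t. f (\<chi> i. (y(m := y n + t)) i) \<partial>lborel \<partial>?M (UNIV - {m}))"
  proof (rule trans)
    show "(\<integral>\<^sup>+x. f (?T x) \<partial>lborel)
        = (\<integral>\<^sup>+y. \<integral>\<^sup>+t. f (?T (\<chi> i. (y(m := t)) i)) \<partial>lborel \<partial>?M (UNIV - {m}))"
      by (rule split) simp
    show "\<dots> = (\<integral>\<^sup>+y. \<integral>\<^sup>+t. f (\<chi> i. (y(m := y n + t)) i) \<partial>lborel \<partial>?M (UNIV - {m}))"
      using mn by (intro nn_integral_cong arg_cong[of _ _ f]) (auto simp: vec_eq_iff)
  qed
  also have "\<dots> = (\<integral>\<^sup>+y. \<integral>\<^sup>+t. f (\<chi> i. (y(m := t)) i) \<partial>lborel \<partial>?M (UNIV - {m}))"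
  proof (rule nn_integral_cong)
    fix y :: "'n \<Rightarrow> real"
    have "continuous_on UNIV (\<lambda>t. (y(m := t)) i)" for i
      by (cases "i = m") auto
    then have "(\<lambda>t. (\<chi> i. (y(m := t)) i) :: real^'n) \<in> borel \<rightarrow>\<^sub>M borel"
      by (intro borel_measurable_continuous_onI continuous_on_vec_lambda)
    then have "(\<lambda>t. f (\<chi> i. (y(m := t)) i)) \<in> borel_measurable borel"
      by (rule measurable_compose) simp
    then show "(\<integral>\<^sup>+t. f (\<chi> i. (y(m := y n + t)) i) \<partial>lborel) = (\<integral>\<^sup>+t. f (\<chi> i. (y(m := t)) i) \<partial>lborel)"
      using nn_integral_real_affine[of "\<lambda>t. f (\<chi> i. (y(m := t)) i)" 1 "y n"] by simp
  qed
  also have "\<dots> = (\<integral>\<^sup>+x. f x \<partial>lborel)" by (simp add: split)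
  finally show ?thesis .
qed

text \<open>The preimage of a box is the box with its sides permuted by \<open>inv p\<close>, and
  the product of the side lengths does not depend on their order.\<close>

lemma nn_integral_permute_cart:
  fixes f :: "real^'n \<Rightarrow> ennreal"
  assumes [measurable]: "f \<in> borel_measurable borel" and p: "p permutes UNIV"
  shows "(\<integral>\<^sup>+x. f (\<chi> i. x $ p i) \<partial>lborel) = (\<integral>\<^sup>+x. f x \<partial>lborel)"
proof -
  let ?T = "\<lambda>x. (\<chi> i. x $ p i) :: real^'n"
  have [measurable]: "?T \<in> borel \<rightarrow>\<^sub>M borel"
    by (intro borel_measurable_continuous_onI continuous_on_vec_lambda) (auto intro!: continuous_intros)
  have "lborel = distr lborel borel ?T"
  proof (rule lborel_eqI)
    fix l u :: "real^'n"
    assume le: "\<And>b. b \<in> Basis \<Longrightarrow> l \<bullet> b \<le> u \<bullet> b"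
    then have le: "l $ i \<le> u $ i" for i
      by (metis axis_in_Basis_iff cart_eq_inner_axis insertI1 Basis_real_def)
    let ?S = "\<lambda>x. (\<chi> i. x $ inv p i) :: real^'n"
    have "?T -` box l u = box (?S l) (?S u)"
      by (auto simp: mem_box_cart) (metis p permutes_inverses)+
    then have "emeasure (distr lborel borel ?T) (box l u) = emeasure lborel (box (?S l) (?S u))"
      by (simp add: emeasure_distr)
    also have "\<dots> = (\<Prod>b\<in>Basis. (?S u - ?S l) \<bullet> b)"
      using le by (subst emeasure_lborel_box_eq) (auto simp: Basis_vec_def inner_axis)
    also have "(\<Prod>b\<in>Basis. (?S u - ?S l) \<bullet> b) = (\<Prod>b\<in>Basis. (u - l) \<bullet> b)"
      using prod.permute[OF permutes_inv[OF p], of "\<lambda>i. u $ i - l $ i"]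
      by (simp add: prod_Basis_cart inner_axis o_def)
    finally show "emeasure (distr lborel borel ?T) (box l u) = (\<Prod>b\<in>Basis. (u - l) \<bullet> b)" .
  qed simp
  then have "(\<integral>\<^sup>+x. f x \<partial>lborel) = (\<integral>\<^sup>+x. f x \<partial>distr lborel borel ?T)"
    by (rule arg_cong)
  then show ?thesis by (simp add: nn_integral_distr)
qed

text \<open>The change of variables theorem of the library requires a well-ordered index type, which
  neither \<open>'n\<close> nor \<open>'n option\<close> is.\<close>

lemma nn_integral_linear_cart:
  fixes A :: "real^'n^'n" and f :: "real^'n \<Rightarrow> ennreal"
  assumes "f \<in> borel_measurable borel" "det A \<noteq> 0"
  shows "(\<integral>\<^sup>+x. f x \<partial>lborel) = ennreal \<bar>det A\<bar> * (\<integral>\<^sup>+x. f (A *v x) \<partial>lborel)"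
proof -
  \<comment> \<open>Nonsingularity is a premise inside the predicate because the induction on
    elementary matrices also passes through singular ones, such as those with a zero row. The
    function is quantified inside because the product case applies the hypothesis for
    \<open>B\<close> to \<open>f\<close> composed with \<open>A\<close>.\<close>
  let ?P = "\<lambda>A :: real^'n^'n. det A \<noteq> 0 \<longrightarrow> (\<forall>f \<in> borel_measurable borel.
      (\<integral>\<^sup>+x. f x \<partial>lborel) = ennreal \<bar>det A\<bar> * (\<integral>\<^sup>+x. f (A *v x) \<partial>lborel))"
  have "?P A"
  proof (induction A rule: induct_matrix_elementary_alt)
    fix A B :: "real^'n^'n"
    assume A: "?P A" and B: "?P B"
    show "?P (A ** B)"
    proof (intro impI ballI)
      fix f :: "real^'n \<Rightarrow> ennreal"
      assume nz: "det (A ** B) \<noteq> 0" and [measurable]: "f \<in> borel_measurable borel"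
      have "(\<integral>\<^sup>+x. f x \<partial>lborel) = ennreal \<bar>det A\<bar> * (\<integral>\<^sup>+x. f (A *v x) \<partial>lborel)"
        by (rule A[THEN mp, THEN bspec]) (use nz in \<open>auto simp: det_mul\<close>)
      also have "(\<integral>\<^sup>+x. f (A *v x) \<partial>lborel) = ennreal \<bar>det B\<bar> * (\<integral>\<^sup>+x. f (A *v (B *v x)) \<partial>lborel)"
        by (rule B[THEN mp, THEN bspec]) (use nz in \<open>auto simp: det_mul\<close>)
      finally show "(\<integral>\<^sup>+x. f x \<partial>lborel) = ennreal \<bar>det (A ** B)\<bar> * (\<integral>\<^sup>+x. f (A ** B *v x) \<partial>lborel)"
        by (simp add: det_mul abs_mult ennreal_mult' mult.assoc matrix_vector_mul_assoc)
    qed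
  next
    fix A :: "real^'n^'n" and i
    assume "row i A = 0"
    then show "?P A" by (simp add: det_zero_row)
  next
    fix A :: "real^'n^'n"
    assume diag: "\<And>i j. i \<noteq> j \<Longrightarrow> A $ i $ j = 0"
    show "?P A"
    proof (intro impI ballI)
      fix f :: "real^'n \<Rightarrow> ennreal"
      assume nz: "det A \<noteq> 0" and [measurable]: "f \<in> borel_measurable borel"
      let ?c = "\<lambda>b :: real^'n. (A *v b) \<bullet> b"
      have det: "det A = (\<Prod>i\<in>UNIV. A $ i $ i)" using diag by (rule det_diagonal)
      have c: "?c (axis i 1) = A $ i $ i" for i
        by (simp add: inner_axis matrix_vector_mult_basis column_def)
      have c_nz: "?c b \<noteq> 0" if "b \<in> Basis" for b :: "real^'n"
      proof -
        obtain i where "b = axis i 1" using \<open>b \<in> Basis\<close> by (auto simp: Basis_vec_def)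
        then show ?thesis using nz by (simp only: c det) simp
      qed
      have Ax: "(A *v x) $ i = A $ i $ i * x $ i" for x i
      proof -
        have "(A *v x) $ i = (\<Sum>j\<in>UNIV. A $ i $ j * x $ j)"
          by (simp add: matrix_vector_mult_def)
        also have "\<dots> = (\<Sum>j\<in>UNIV. if j = i then A $ i $ i * x $ i else 0)"
          by (rule sum.cong) (auto simp: diag)
        finally show ?thesis by simp
      qed
      \<comment> \<open>A diagonal matrix is brought into the form that
        \<open>lborel_affine_euclidean\<close> expects: a scaling along each basis vector, here with
        translation \<open>0\<close>.\<close>
      have T: "0 + (\<Sum>b\<in>Basis. (?c b * (x \<bullet> b)) *\<^sub>R b) = A *v x" for x
      proof (rule euclidean_eqI)
        fix b :: "real^'n" assume b: "b \<in> Basis"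
        then obtain i where i: "b = axis i 1" by (auto simp: Basis_vec_def)
        show "(0 + (\<Sum>b\<in>Basis. (?c b * (x \<bullet> b)) *\<^sub>R b)) \<bullet> b = (A *v x) \<bullet> b"
          by (simp only: add_0 inner_sum_left_Basis[OF b]) (simp only: i c Ax inner_axis, simp)
      qed
      have "lborel = density (distr lborel borel (\<lambda>x. A *v x)) (\<lambda>_. \<Prod>b\<in>Basis. \<bar>?c b\<bar>)"
        using lborel_affine_euclidean[of ?c 0, OF c_nz] unfolding T .
      also have "(\<Prod>b\<in>Basis. \<bar>?c b\<bar>) = \<bar>det A\<bar>"
        by (simp add: prod_Basis_cart c det abs_prod)
      finally have "(\<integral>\<^sup>+x. f x \<partial>lborel) = (\<integral>\<^sup>+x. f x \<partial>density (distr lborel borel (\<lambda>x. A *v x)) (\<lambda>_. \<bar>det A\<bar>))"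
        by (rule arg_cong)
      then show "(\<integral>\<^sup>+x. f x \<partial>lborel) = ennreal \<bar>det A\<bar> * (\<integral>\<^sup>+x. f (A *v x) \<partial>lborel)"
        by (simp add: nn_integral_density nn_integral_distr nn_integral_cmult)
    qed
  next
    fix m n :: 'n
    assume "m \<noteq> n"
    let ?A = "(\<chi> i j. mat 1 $ i $ Transposition.transpose m n j) :: real^'n^'n"
    have p: "Transposition.transpose m n permutes UNIV" by (simp add: permutes_swap_id)
    have "?A *v x = (\<chi> i. x $ Transposition.transpose m n i)" for x
    proof -
      have "(\<Sum>j\<in>UNIV. (if i = Transposition.transpose m n j then 1 else 0) * x $ j)
        = (\<Sum>j\<in>UNIV. if j = Transposition.transpose m n i then x $ j else 0)" for i
        by (intro sum.cong) (auto)
      then show ?thesis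
        by (simp add: vec_eq_iff matrix_vector_mult_def mat_def)
    qed
    moreover have "\<bar>det ?A\<bar> = 1"
      using det_permute_columns[OF p, of "mat 1 :: real^'n^'n"] by (simp add: sign_def)
    ultimately show "?P ?A" using nn_integral_permute_cart[OF _ p] by simp
  next
    fix m n :: 'n
    assume mn: "m \<noteq> n"
    let ?A = "(\<chi> i j. of_bool (i = m \<and> j = n \<or> i = j)) :: real^'n^'n"
    have "?A *v x = (\<chi> i. if i = m then x $ m + x $ n else x $ i)" for x
    proof -
      have "(\<Sum>j\<in>UNIV. of_bool (i = m \<and> j = n \<or> i = j) * x $ j)
        = (\<Sum>j\<in>UNIV. (if j = i then x $ j else 0) + (if j = n then if i = m then x $ j else 0 else 0))" for i
        using mn by (intro sum.cong) auto
      then show ?thesis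
        by (auto simp: vec_eq_iff matrix_vector_mult_def sum.distrib)
    qed
    moreover have "det ?A = 1"
    proof -
      \<comment> \<open>The shear matrix is the identity with row \<open>n\<close> added to row
        \<open>m\<close>, and such a row operation preserves the determinant.\<close>
      have "?A = (\<chi> k. if k = m then row m (mat 1) + 1 *s row n (mat 1) else row k (mat 1))"
        using mn by (auto simp: vec_eq_iff row_def mat_def)
      then show ?thesis by (simp only: det_row_operation[OF mn] det_I)
    qed
    ultimately show "?P ?A" using nn_integral_shear[OF _ mn] by simp
  qed
  then show ?thesis using assms by blast
qed

text \<open>Stating the substitution as an identity of measures carries it over to Bochner integrals
  of any measurable function, with no integrability to check.\<close>

lemma lborel_linear_cart:
  fixes A :: "real^'n^'n"
  assumes "det A \<noteq> 0"
  shows "lborel = density (distr lborel borel (\<lambda>x. t + A *v x)) (\<lambda>_. ennreal \<bar>det A\<bar>)"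
proof (rule measure_eqI)
  fix X :: "(real^'n) set" assume "X \<in> sets lborel"
  then have [measurable]: "X \<in> sets borel" by simp
  have "emeasure lborel X = emeasure (distr lborel borel ((+) t)) X"
    by (simp add: lborel_distr_plus)
  also have "\<dots> = (\<integral>\<^sup>+x. indicator X (t + x) \<partial>lborel)"
    using nn_integral_distr[of "(+) t" lborel borel "indicator X"] by simp
  also have "\<dots> = ennreal \<bar>det A\<bar> * (\<integral>\<^sup>+x. indicator X (t + A *v x) \<partial>lborel)"
    by (rule nn_integral_linear_cart) (use assms in auto)
  finally show "emeasure lborel X
      = emeasure (density (distr lborel borel (\<lambda>x. t + A *v x)) (\<lambda>_. ennreal \<bar>det A\<bar>)) X"
    by (simp add: emeasure_density nn_integral_distr nn_integral_cmult del: nn_integral_indicator)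
qed simp

lemma integral_linear_cart:
  fixes A :: "real^'n^'n" and f :: "real^'n \<Rightarrow> real"
  assumes "det A \<noteq> 0" and [measurable]: "f \<in> borel_measurable borel"
  shows "(\<integral>x. f x \<partial>lborel) = \<bar>det A\<bar> * (\<integral>x. f (t + A *v x) \<partial>lborel)"
  by (subst lborel_linear_cart[OF assms(1), of t]) (simp add: integral_density integral_distr)

section \<open>Kullback-Leibler divergence of normal distributions\<close>

text \<open>The product form makes moments factor over the coordinates;
  \<open>std_mvn_density_eq\<close> recovers the usual exponential form.\<close>

definition std_mvn_density :: "real^'n \<Rightarrow> real" where
  "std_mvn_density y = (\<Prod>i\<in>UNIV. std_normal_density (y $ i))"

lemma std_mvn_density_eq:
  "std_mvn_density y = exp (- (1/2) * (y \<bullet> y)) / sqrt ((2 * pi) ^ CARD('n))" for y :: "real^'n"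
proof -
  have "std_mvn_density y = (1 / sqrt (2 * pi)) ^ CARD('n) * exp (\<Sum>i\<in>UNIV. - (y $ i)\<^sup>2 / 2)"
    by (simp only: std_mvn_density_def std_normal_density_def prod.distrib exp_sum finite_class.finite_UNIV prod_constant)
  also have "(\<Sum>i\<in>UNIV. - (y $ i)\<^sup>2 / 2) = - (1/2) * (y \<bullet> y)"
    by (simp add: inner_vec_def power2_eq_square sum_negf sum_divide_distrib)
  finally show ?thesis unfolding real_sqrt_power by (simp add: power_divide)
qed

text \<open>The moments of order 0, 1 and 2 of the one-dimensional standard normal distribution are
  1, 0 and 1, so a product of them vanishes exactly when some exponent is 1.\<close>

lemma std_mvn_moment:
  fixes e :: "'n::finite \<Rightarrow> nat"
  assumes "\<And>i. e i \<le> 2"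
  shows "has_bochner_integral lborel (\<lambda>y. std_mvn_density y * (\<Prod>i\<in>UNIV. y $ i ^ e i))
    (of_bool (\<forall>i. e i \<noteq> 1))"
proof -
  have "has_bochner_integral lborel (\<lambda>t. std_normal_density t * t ^ k) (of_bool (k \<noteq> 1))" if "k \<le> 2" for k
  proof -
    have "k = 0 \<or> k = 1 \<or> k = 2" using that by linarith
    then show ?thesis
      using std_normal_moment_even[of 0] std_normal_moment_odd[of 0] std_normal_moment_even[of 1]
      by (elim disjE) (simp_all add: fact_numeral)
  qed
  then have "has_bochner_integral lborel (\<lambda>y :: real^'n. \<Prod>i\<in>UNIV. std_normal_density (y $ i) * (y $ i) ^ e i)
     (\<Prod>i\<in>UNIV. of_bool (e i \<noteq> 1))"
    using assms by (intro has_bochner_integral_prod_cart) auto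
  also have "(\<Prod>i\<in>UNIV. of_bool (e i \<noteq> 1)) = (of_bool (\<forall>i. e i \<noteq> 1) :: real)"
    by (auto simp: prod_zero_iff)
  finally show ?thesis by (simp add: std_mvn_density_def prod.distrib)
qed

lemma prod_power_of_bool: "(\<Prod>k\<in>UNIV. f k ^ of_bool (k = i)) = (f i :: real)" for i :: "'n::finite"
  by (simp add: power_0 if_distrib of_bool_def cong: if_cong)

text \<open>The coordinates have mean 0 and identity covariance: the linear part integrates to 0,
  and only the diagonal of \<open>C\<close> survives.\<close>

lemma std_mvn_quadratic:
  fixes a :: "real^'n"
  shows "has_bochner_integral lborel (\<lambda>y. std_mvn_density y * (c + a \<bullet> y + y \<bullet> (C *v y))) (c + trace C)"
proof -
  have 0: "has_bochner_integral lborel (\<lambda>y :: real^'n. std_mvn_density y) 1"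
    using std_mvn_moment[of "\<lambda>_. 0"] by simp
  have 1: "has_bochner_integral lborel (\<lambda>y. std_mvn_density y * y $ i) 0" for i :: 'n
  proof -
    have "has_bochner_integral lborel (\<lambda>y. std_mvn_density y * (\<Prod>k\<in>UNIV. y $ k ^ of_bool (k = i)))
      (of_bool (\<forall>k. of_bool (k = i) \<noteq> (1::nat)))"
      by (rule std_mvn_moment) auto
    moreover have "(\<forall>k. of_bool (k = i) \<noteq> (1::nat)) \<longleftrightarrow> False" by auto
    ultimately show ?thesis by (simp only: prod_power_of_bool of_bool_eq)
  qed
  have 2: "has_bochner_integral lborel (\<lambda>y. std_mvn_density y * (y $ i * y $ j)) (of_bool (i = j))" for i j :: 'n
  proof -
    \<comment> \<open>The exponents encode \<open>y $ i * y $ j\<close>: a single 2 if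
      \<open>i = j\<close>, and otherwise a 1 at each of the two places.\<close>
    have "has_bochner_integral lborel
      (\<lambda>y. std_mvn_density y * (\<Prod>k\<in>UNIV. y $ k ^ (of_bool (k = i) + of_bool (k = j))))
      (of_bool (\<forall>k. of_bool (k = i) + of_bool (k = j) \<noteq> (1::nat)))"
      by (rule std_mvn_moment) auto
    moreover have "(\<forall>k. of_bool (k = i) + of_bool (k = j) \<noteq> (1::nat)) \<longleftrightarrow> i = j" by auto
    ultimately show ?thesis by (simp add: power_add prod.distrib prod_power_of_bool)
  qed
  have "has_bochner_integral lborel
    (\<lambda>y. c * std_mvn_density y + (\<Sum>i\<in>UNIV. a $ i * (std_mvn_density y * y $ i))
       + (\<Sum>i\<in>UNIV. \<Sum>j\<in>UNIV. C $ i $ j * (std_mvn_density y * (y $ i * y $ j))))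
    (c * 1 + (\<Sum>i\<in>UNIV. a $ i * 0) + (\<Sum>i\<in>UNIV. \<Sum>j\<in>UNIV. C $ i $ j * of_bool (i = j)))"
    by (intro has_bochner_integral_add has_bochner_integral_sum has_bochner_integral_mult_right 0 1 2)
  moreover have "c * std_mvn_density y + (\<Sum>i\<in>UNIV. a $ i * (std_mvn_density y * y $ i))
       + (\<Sum>i\<in>UNIV. \<Sum>j\<in>UNIV. C $ i $ j * (std_mvn_density y * (y $ i * y $ j)))
     = std_mvn_density y * (c + a \<bullet> y + y \<bullet> (C *v y))" for y :: "real^'n"
    by (simp add: inner_vec_def matrix_vector_mult_def distrib_left sum_distrib_left mult_ac)
  moreover have "(\<Sum>i\<in>UNIV. \<Sum>j\<in>UNIV. C $ i $ j * of_bool (i = j)) = trace C"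
    by (simp add: trace_def of_bool_def if_distrib cong: if_cong)
  ultimately show ?thesis by simp
qed

lemma mvn_density_pos: "\<Sigma> \<in> spd_matrices \<Longrightarrow> mvn_density \<mu> \<Sigma> x > 0"
  by (simp add: mvn_density_def spd_det_pos)

lemma ln_mvn_density:
  fixes \<Sigma> :: "real^'n^'n"
  assumes "\<Sigma> \<in> spd_matrices"
  shows "ln (mvn_density \<mu> \<Sigma> x) = - (1/2) * ((x - \<mu>) \<bullet> (matrix_inv \<Sigma> *v (x - \<mu>)))
     - (1/2) * ln ((2 * pi) ^ CARD('n)) - (1/2) * ln (det \<Sigma>)"
proof -
  have "ln (sqrt ((2 * pi) ^ CARD('n) * det \<Sigma>)) = (1/2) * ln ((2 * pi) ^ CARD('n)) + (1/2) * ln (det \<Sigma>)"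
    using spd_det_pos[OF assms] by (subst ln_sqrt) (simp_all add: ln_mult_pos add_divide_distrib)
  then show ?thesis
    using spd_det_pos[OF assms] by (simp add: mvn_density_def ln_div)
qed

text \<open>The vector \<open>transpose (matrix_inv A) *v y\<close> solves the system with matrix
  \<open>A ** transpose A\<close> and right-hand side \<open>A *v y\<close>; pairing it with
  \<open>A *v y\<close> cancels \<open>A\<close>.\<close>

lemma inverse_form_factor:
  fixes A :: "real^'n^'n"
  assumes "invertible A"
  shows "(A *v y) \<bullet> (matrix_inv (A ** transpose A) *v (A *v y)) = y \<bullet> y"
proof -
  have inv: "invertible (A ** transpose A)"
    using assms by (simp add: invertible_det_nz det_mul)
  let ?z = "transpose (matrix_inv A) *v y"
  have T: "transpose A ** transpose (matrix_inv A) = mat 1"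
    by (metis assms matrix_inv_mult(2) matrix_transpose_mul transpose_mat)
  have "(A ** transpose A) *v ?z = A *v ((transpose A ** transpose (matrix_inv A)) *v y)"
    by (simp only: matrix_vector_mul_assoc matrix_mul_assoc)
  then have "(A ** transpose A) *v ?z = A *v y" by (simp add: T)
  then have "matrix_inv (A ** transpose A) *v (A *v y) = ?z"
    by (metis inv matrix_inv_vec(2))
  then show ?thesis
    by (metis assms inner_matvec_transpose inner_commute matrix_inv_vec(2) transpose_transpose)
qed

lemma borel_measurable_mvn_density [measurable]: "mvn_density \<mu> \<Sigma> \<in> borel_measurable borel"
  unfolding mvn_density_def[abs_def] by measurable

text \<open>The Jacobian \<open>\<bar>det A\<bar>\<close> cancels the square root of
  \<open>det (A ** transpose A)\<close> in the normalizing constant.\<close>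

lemma mvn_density_affine:
  fixes A :: "real^'n^'n"
  assumes "invertible A"
  shows "\<bar>det A\<bar> * mvn_density \<mu> (A ** transpose A) (\<mu> + A *v y) = std_mvn_density y"
proof -
  have nz: "det A \<noteq> 0" using assms by (simp add: invertible_det_nz)
  have "sqrt ((2 * pi) ^ CARD('n) * det (A ** transpose A)) = sqrt ((2 * pi) ^ CARD('n)) * \<bar>det A\<bar>"
    by (simp add: det_mul real_sqrt_mult)
  then show ?thesis
    using nz by (simp add: mvn_density_def std_mvn_density_eq inverse_form_factor assms)
qed

lemma kl_div_mvn:
  fixes \<mu>1 \<mu>2 :: "real^'n"
  assumes S1: "\<Sigma>1 \<in> spd_matrices" and S2: "\<Sigma>2 \<in> spd_matrices"
  shows "kl_div (mvn_density \<mu>1 \<Sigma>1) (mvn_density \<mu>2 \<Sigma>2) =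
    1/2 * (ln (det \<Sigma>2) - ln (det \<Sigma>1) - real CARD('n) + matrix_inv \<Sigma>2 \<bullet> \<Sigma>1
      + (\<mu>1 - \<mu>2) \<bullet> (matrix_inv \<Sigma>2 *v (\<mu>1 - \<mu>2)))"
proof -
  obtain A :: "real^'n^'n" where A: "invertible A" and S1A: "\<Sigma>1 = A ** transpose A"
    using spd_factorization[OF S1] by blast
  define S where "S = matrix_inv \<Sigma>2"
  define \<delta> where "\<delta> = \<mu>1 - \<mu>2"
  have Ssym: "transpose S = S" using sym_matrix_inv[OF S2] by (simp add: S_def)
  let ?p = "mvn_density \<mu>1 \<Sigma>1" and ?q = "mvn_density \<mu>2 \<Sigma>2"
  \<comment> \<open>Coefficients of the log-ratio as a polynomial in \<open>y\<close>. The
    \<open>mat 1\<close> in \<open>?C\<close> comes from the first density, whose exponent becomes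
    \<open>- (y \<bullet> y) / 2\<close>; its trace later yields the dimension. The powers of
    \<open>2 * pi\<close> cancel.\<close>
  let ?c = "1/2 * (ln (det \<Sigma>2) - ln (det \<Sigma>1) + \<delta> \<bullet> (S *v \<delta>))"
  let ?a = "transpose A *v (S *v \<delta>)"
  let ?C = "(1/2) *\<^sub>R (transpose A ** (S ** A) - mat 1)"
  have ln_pq: "ln (?p (\<mu>1 + A *v y) / ?q (\<mu>1 + A *v y)) = ?c + ?a \<bullet> y + y \<bullet> (?C *v y)" for y
  proof -
    let ?x = "\<mu>1 + A *v y"
    have x2: "?x - \<mu>2 = \<delta> + A *v y" by (simp add: \<delta>_def)
    have "ln (?p ?x / ?q ?x) = ln (?p ?x) - ln (?q ?x)"
      by (intro ln_divide_pos mvn_density_pos S1 S2)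
    also have "\<dots> = 1/2 * (ln (det \<Sigma>2) - ln (det \<Sigma>1)) - 1/2 * (y \<bullet> y)
        + 1/2 * ((\<delta> + A *v y) \<bullet> (S *v (\<delta> + A *v y)))"
      using inverse_form_factor[OF A, of y]
      by (simp add: ln_mvn_density S1 S2 x2 algebra_simps flip: S1A S_def)
    also have "(\<delta> + A *v y) \<bullet> (S *v (\<delta> + A *v y))
        = \<delta> \<bullet> (S *v \<delta>) + 2 * (?a \<bullet> y) + y \<bullet> ((transpose A ** (S ** A)) *v y)"
    proof -
      have 1: "\<delta> \<bullet> (S *v (A *v y)) = ?a \<bullet> y"
        by (metis Ssym inner_matvec_transpose)
      have 2: "(A *v y) \<bullet> (S *v \<delta>) = ?a \<bullet> y"
        by (metis inner_matvec_transpose inner_commute)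
      have 3: "(A *v y) \<bullet> (S *v (A *v y)) = y \<bullet> ((transpose A ** (S ** A)) *v y)"
        by (metis inner_matvec_transpose inner_commute matrix_vector_mul_assoc)
      show ?thesis
        using 1 2 3 by (simp only: matrix_vector_right_distrib inner_add_left inner_add_right)
    qed
    finally show ?thesis
      by (simp add: scaleR_matrix_vector_assoc [symmetric] matrix_vector_mult_diff_rdistrib
          inner_diff_right algebra_simps)
  qed
  have det: "det A \<noteq> 0" using A by (simp add: invertible_det_nz)
  have "kl_div ?p ?q = \<bar>det A\<bar> * (\<integral>y. ?p (\<mu>1 + A *v y) * ln (?p (\<mu>1 + A *v y) / ?q (\<mu>1 + A *v y)) \<partial>lborel)"
    unfolding kl_div_def by (rule integral_linear_cart[OF det]) measurable
  also have "\<dots> = (\<integral>y. (\<bar>det A\<bar> * ?p (\<mu>1 + A *v y)) * (?c + ?a \<bullet> y + y \<bullet> (?C *v y)) \<partial>lborel)"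
    by (simp only: ln_pq integral_mult_right_zero [symmetric] mult.assoc)
  also have "\<dots> = (\<integral>y. std_mvn_density y * (?c + ?a \<bullet> y + y \<bullet> (?C *v y)) \<partial>lborel)"
    by (simp only: S1A mvn_density_affine[OF A])
  also have "\<dots> = ?c + trace ?C"
    by (rule has_bochner_integral_integral_eq[OF std_mvn_quadratic])
  also have "trace ?C = 1/2 * (trace (transpose A ** (S ** A)) - real CARD('n))"
    by (simp add: trace_def sum_distrib_left sum_subtractf mat_def sum_divide_distrib diff_divide_distrib)
  also have "trace (transpose A ** (S ** A)) = trace (S ** \<Sigma>1)"
    by (metis S1A trace_mul_sym matrix_mul_assoc)
  also have "\<dots> = S \<bullet> \<Sigma>1"
    using S1 by (intro trace_mult_eq_inner) (simp add: spd_matrices_def)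
  finally show ?thesis by (simp add: S_def \<delta>_def algebra_simps)
qed

section \<open>Gradients of the log-normalizers\<close>

lemma has_derivative_entry: "((\<lambda>A :: real^'n^'m. A $ i $ j) has_derivative (\<lambda>H. H $ i $ j)) F"
  by (intro bounded_linear_imp_has_derivative bounded_linear_compose[OF bounded_linear_vec_nth] bounded_linear_vec_nth)

lemma has_derivative_det_sum:
  "(det has_derivative (\<lambda>H. \<Sum>p | p permutes UNIV. of_int (sign p) *
      (\<Sum>i\<in>UNIV. H $ i $ p i * (\<Prod>j\<in>UNIV - {i}. A $ j $ p j)))) (at (A :: real^'n^'n))"
  unfolding det_def[abs_def]
  by (intro has_derivative_sum has_derivative_mult_right has_derivative_prod has_derivative_entry)

text \<open>A permutation other than the identity moves at least two points, so after one factor of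
  its Leibniz term is differentiated, another off-diagonal zero remains. Only the identity
  permutation contributes.\<close>

lemma has_derivative_det_mat_1: "(det has_derivative trace) (at (mat 1 :: real^'n^'n))"
proof -
  have *: "(\<Sum>i\<in>UNIV. H $ i $ p i * (\<Prod>j\<in>UNIV - {i}. (mat 1 :: real^'n^'n) $ j $ p j)) = 0"
    if p: "p permutes UNIV" "p \<noteq> id" for p and H :: "real^'n^'n"
  proof (intro sum.neutral ballI)
    fix i
    have "\<exists>j. j \<noteq> i \<and> p j \<noteq> j"
    proof (rule ccontr)
      assume *: "\<not> (\<exists>j. j \<noteq> i \<and> p j \<noteq> j)"
      moreover have "p i = i"
        by (metis * p(1) permutes_inj injD)
      ultimately show False using p(2) by (auto simp: fun_eq_iff)
    qed
    then obtain j where "j \<noteq> i" "p j \<noteq> j" by blast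
    then have "(\<Prod>j\<in>UNIV - {i}. (mat 1 :: real^'n^'n) $ j $ p j) = 0"
      by (intro prod_zero) (auto simp: mat_def intro!: bexI[of _ j])
    then show "H $ i $ p i * (\<Prod>j\<in>UNIV - {i}. (mat 1 :: real^'n^'n) $ j $ p j) = 0" by simp
  qed
  have "(\<Sum>p | p permutes UNIV. of_int (sign p) *
      (\<Sum>i\<in>UNIV. H $ i $ p i * (\<Prod>j\<in>UNIV - {i}. (mat 1 :: real^'n^'n) $ j $ p j))) = trace H"
    (is "?S = _") for H :: "real^'n^'n"
  proof -
    have "?S = (\<Sum>p\<in>{id}. of_int (sign p) *
      (\<Sum>i\<in>UNIV. H $ i $ p i * (\<Prod>j\<in>UNIV - {i}. (mat 1 :: real^'n^'n) $ j $ p j)))"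
      by (rule sum.mono_neutral_right) (auto simp: * permutes_id)
    then show ?thesis by (simp add: trace_def mat_def)
  qed
  then show ?thesis using has_derivative_det_sum[of "mat 1 :: real^'n^'n"] by simp
qed

lemma bounded_bilinear_matrix_mult: "bounded_bilinear (\<lambda>(A :: real^'n^'m) (B :: real^'p^'n). A ** B)"
  unfolding bilinear_conv_bounded_bilinear[symmetric] bilinear_def
  by (auto intro!: linearI simp: matrix_matrix_mult_def vec_eq_iff algebra_simps sum.distrib sum_distrib_left)

lemma bounded_bilinear_matrix_vector: "bounded_bilinear (\<lambda>(A :: real^'n^'m) x. A *v x)"
  unfolding bilinear_conv_bounded_bilinear[symmetric] bilinear_def
  by (auto intro!: linearI simp: matrix_vector_mult_def vec_eq_iff algebra_simps sum.distrib sum_distrib_left)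

text \<open>Jacobi's formula, moved from the identity to \<open>M\<close> by writing
  \<open>det X\<close> as \<open>det M * det (matrix_inv M ** X)\<close>.\<close>

lemma has_derivative_det:
  fixes M :: "real^'n^'n"
  assumes M: "invertible M"
  shows "(det has_derivative (\<lambda>H. det M * trace (matrix_inv M ** H))) (at M)"
proof -
  have lin: "((\<lambda>X. matrix_inv M ** X) has_derivative (\<lambda>H. matrix_inv M ** H)) (at M)"
    by (intro bounded_linear_imp_has_derivative bounded_bilinear.bounded_linear_right
        bounded_bilinear_matrix_mult)
  have "((\<lambda>X. det (matrix_inv M ** X)) has_derivative (\<lambda>H. trace (matrix_inv M ** H))) (at M)"
    using has_derivative_compose[OF lin, of det trace] has_derivative_det_mat_1
    by (simp add: matrix_inv_mult M)
  then have "((\<lambda>X. det M * det (matrix_inv M ** X)) has_derivative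
      (\<lambda>H. det M * trace (matrix_inv M ** H))) (at M)"
    by (rule has_derivative_mult_right)
  moreover have "det M * det (matrix_inv M ** X) = det X" for X
    using M by (simp add: det_mul det_matrix_inv invertible_det_nz)
  ultimately show ?thesis by simp
qed

lemma differentiable_det: "det differentiable (at A)" for A :: "real^'n^'n"
  using has_derivative_det_sum unfolding differentiable_def by blast

section \<open>Derivative of the solution of a linear system\<close>

lemma eventually_invertible:
  fixes M :: "real^'n^'n"
  assumes "invertible M"
  shows "\<forall>\<^sub>F X in nhds M. invertible X"
proof -
  have "isCont det M"
    using differentiable_det differentiable_imp_continuous_within by blast
  then have "(det \<longlongrightarrow> det M) (nhds M)"
    by (simp add: isCont_def tendsto_at_iff_tendsto_nhds)
  moreover have "det M \<noteq> 0" using assms by (simp add: invertible_det_nz)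
  ultimately have "\<forall>\<^sub>F X in nhds M. det X \<noteq> 0" by (rule tendsto_imp_eventually_ne)
  then show ?thesis by (simp add: invertible_det_nz)
qed

text \<open>Cramer's rule gives differentiability; the derivative itself is then forced by differentiating
  the identity \<open>X *v (matrix_inv X *v v) = v\<close>.\<close>

lemma has_derivative_matrix_inv_vec:
  fixes M :: "real^'n^'n" and v :: "real^'n"
  assumes M: "invertible M"
  shows "((\<lambda>(v, X). matrix_inv X *v v) has_derivative
      (\<lambda>(h, H). matrix_inv M *v (h - H *v (matrix_inv M *v v)))) (at (v, M))"
proof -
  let ?g = "\<lambda>z :: (real^'n) \<times> (real^'n^'n). matrix_inv (snd z) *v fst z"
  \<comment> \<open>Cramer's numerators: column \<open>k\<close> of the matrix is replaced by the
    right-hand side.\<close>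
  let ?R = "\<lambda>k z :: (real^'n) \<times> (real^'n^'n). (\<chi> i j. if j = k then fst z $ i else snd z $ i $ j) :: real^'n^'n"
  let ?c = "\<lambda>z. (\<chi> k. det (?R k z) / det (snd z)) :: real^'n"
  have detM: "det M \<noteq> 0" using M by (simp add: invertible_det_nz)
  have "(snd \<longlongrightarrow> M) (nhds (v, M))"
    using tendsto_snd[OF filterlim_ident[of "nhds (v, M)"]] by simp
  \<comment> \<open>The value of \<open>matrix_inv\<close> at a singular matrix is unspecified, so
    the identities below hold only near \<open>(v, M)\<close>; that is enough for
    derivatives.\<close>
  then have ev: "\<forall>\<^sub>F z in nhds (v, M). invertible (snd z)"
    using eventually_invertible[OF M] filterlim_iff by blast
  have cramer: "?c z = ?g z" if "invertible (snd z)" for z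
  proof -
    have "det (snd z) \<noteq> 0" using that by (simp add: invertible_det_nz)
    then have "?g z = ?c z \<longleftrightarrow> snd z *v ?g z = fst z" using cramer[of "snd z" "?g z" "fst z"] by auto
    then show ?thesis using that by (simp add: matrix_inv_vec)
  qed
  have "?c differentiable (at (v, M))"
  proof (subst differentiable_componentwise_within, intro ballI)
    fix b :: "real^'n" assume "b \<in> Basis"
    then obtain k where b: "b = axis k 1" by (auto simp: Basis_vec_def)
    have "linear (?R k)"
      by (auto intro!: linearI simp: vec_eq_iff)
    then have "?R k differentiable (at (v, M))"
      by (rule linear_imp_differentiable)
    then have "(\<lambda>z. det (?R k z)) differentiable (at (v, M))"
      using differentiable_chain_at[of "?R k" "(v, M)" det, OF _ differentiable_det] unfolding o_def by blast
    moreover have "(\<lambda>z. det (snd z)) differentiable (at (v, M))"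
      using differentiable_chain_at[of snd "(v, M)" det, OF linear_imp_differentiable[OF linear_snd] differentiable_det]
      unfolding o_def by simp
    ultimately show "(\<lambda>z. ?c z \<bullet> b) differentiable (at (v, M))"
      using detM by (simp add: b inner_axis)
  qed
  then obtain D where D: "(?c has_derivative D) (at (v, M))"
    by (auto simp: differentiable_def)
  have gD: "(?g has_derivative D) (at (v, M))"
  proof (rule has_derivative_transform_eventually[OF D])
    show "\<forall>\<^sub>F z in at (v, M). ?c z = ?g z"
      using ev cramer by (auto simp: eventually_at_filter elim: eventually_mono)
    show "?c (v, M) = ?g (v, M)" using cramer[of "(v, M)"] M by simp
  qed simp
  have "((\<lambda>z. snd z *v ?g z) has_derivative (\<lambda>z. M *v D z + snd z *v ?g (v, M))) (at (v, M))"
    using bounded_bilinear.FDERIV[OF bounded_bilinear_matrix_vector has_derivative_snd[OF has_derivative_ident] gD]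
    by simp
  moreover have "((\<lambda>z. snd z *v ?g z) has_derivative fst) (at (v, M))"
  proof (rule has_derivative_transform_eventually[OF has_derivative_fst[OF has_derivative_ident]])
    show "\<forall>\<^sub>F z in at (v, M). fst z = snd z *v ?g z"
      using ev by (auto simp: eventually_at_filter matrix_inv_vec elim: eventually_mono)
    show "fst (v, M) = snd (v, M) *v ?g (v, M)" using M by (simp add: matrix_inv_vec)
  qed simp
  ultimately have eq: "(\<lambda>z. M *v D z + snd z *v ?g (v, M)) = fst"
    by (rule has_derivative_unique)
  have "D z = matrix_inv M *v (fst z - snd z *v ?g (v, M))" for z
  proof -
    have "M *v D z = fst z - snd z *v ?g (v, M)"
      using fun_cong[OF eq, of z] by (simp add: algebra_simps)
    then show ?thesis using M by (metis matrix_inv_vec(2))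
  qed
  then have "D = (\<lambda>(h, H). matrix_inv M *v (h - H *v (matrix_inv M *v v)))"
    by (auto simp: fun_eq_iff)
  then show ?thesis using gD by (simp add: case_prod_unfold)
qed

section \<open>Gradients on a subspace, and those of the log-normalizers\<close>

text \<open>Within a proper subspace the derivative need not be unique as a linear map on the whole
  space. Two candidates in \<open>V\<close> are therefore compared along the line in the direction
  of their difference \<open>d\<close>, which stays in \<open>V\<close>; this forces
  \<open>d \<bullet> d = 0\<close>.\<close>

lemma gradient_on_eqI:
  assumes V: "subspace V" "\<theta> \<in> V" and g: "g \<in> V" "(F has_derivative (\<lambda>h. g \<bullet> h)) (at \<theta> within V)"
  shows "gradient_on V F \<theta> = g"
  unfolding gradient_on_def
proof (rule the_equality)
  fix g' assume g': "g' \<in> V \<and> (F has_derivative (\<lambda>h. g' \<bullet> h)) (at \<theta> within V)"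
  define d where "d = g' - g"
  have d: "d \<in> V" using V g g' by (simp add: d_def subspace_diff)
  let ?l = "\<lambda>t :: real. \<theta> + t *\<^sub>R d"
  have l: "(?l has_derivative (\<lambda>t. t *\<^sub>R d)) (at 0)"
    by (auto intro!: derivative_eq_intros)
  have sub: "range ?l \<subseteq> V" using V d by (auto simp: subspace_add subspace_scale)
  have line: "((\<lambda>t. F (?l t)) has_derivative (\<lambda>t. u \<bullet> (t *\<^sub>R d))) (at 0)"
    if "(F has_derivative (\<lambda>h. u \<bullet> h)) (at \<theta> within V)" for u
    using has_derivative_in_compose[OF l, of F "\<lambda>h. u \<bullet> h"] has_derivative_subset[OF that sub] by simp
  have "(\<lambda>t. g' \<bullet> (t *\<^sub>R d)) = (\<lambda>t. g \<bullet> (t *\<^sub>R d))"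
    using has_derivative_unique line g' g(2) by blast
  then have "g' \<bullet> d = g \<bullet> d" by (metis scaleR_one)
  then have "d \<bullet> d = 0" by (simp add: d_def inner_diff_left)
  then show "g' = g" by (simp add: d_def)
qed (use g in auto)

text \<open>For \<open>M = (1/2) *\<^sub>R matrix_inv \<Sigma>\<close> and
  \<open>v = matrix_inv \<Sigma> *v \<mu>\<close>, the vector \<open>w\<close> is twice the mean,
  and the pair is the mean and the negated second-moment matrix.\<close>

definition grad_N :: "(real^'n) \<times> (real^'n^'n) \<Rightarrow> (real^'n) \<times> (real^'n^'n)" where
  "grad_N = (\<lambda>(v, M). let w = matrix_inv M *v v in
     ((1/2) *\<^sub>R w, - ((1/2) *\<^sub>R matrix_inv M + (1/4) *\<^sub>R outer w w)))"

lemma grad_N_0: "grad_N (0, M) = (0, - ((1/2) *\<^sub>R matrix_inv M))"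
  by (simp add: grad_N_def outer_def vec_eq_iff)

text \<open>The derivative is taken in the full ambient space, including non-symmetric directions;
  symmetry of \<open>matrix_inv M\<close> lets it be written as an inner product with
  \<open>grad_N (v, M)\<close>.\<close>

lemma has_derivative_F_N:
  fixes M :: "real^'n^'n"
  assumes M: "M \<in> spd_matrices"
  shows "(F_N has_derivative (\<lambda>h. grad_N (v, M) \<bullet> h)) (at (v, M))"
proof -
  have inv: "invertible M" and pos: "det M > 0"
    using M spd_invertible spd_det_pos by blast+
  let ?w = "matrix_inv M *v v"
  note q = has_derivative_inner[OF has_derivative_fst[OF has_derivative_ident]
      has_derivative_matrix_inv_vec[OF inv, of v]]
  have d: "((\<lambda>z. det (snd z)) has_derivative (\<lambda>z. det M * trace (matrix_inv M ** snd z))) (at (v, M))"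
    using has_derivative_compose[OF has_derivative_snd[OF has_derivative_ident], where g = det and x = "(v, M)"]
      has_derivative_det[OF inv] by simp
  have l: "((\<lambda>z. ln (det (snd z))) has_derivative (\<lambda>z. trace (matrix_inv M ** snd z))) (at (v, M))"
    using has_derivative_ln[OF _ d] pos by (simp add: field_simps)
  have "((\<lambda>z. 1/2 * (real CARD('n) * ln pi - ln (det (snd z))
       + 1/2 * (fst z \<bullet> (case z of (v, X) \<Rightarrow> matrix_inv X *v v)))) has_derivative
     (\<lambda>z. 1/2 * (0 - trace (matrix_inv M ** snd z)
       + 1/2 * (fst (v, M) \<bullet> (case z of (h, H) \<Rightarrow> matrix_inv M *v (h - H *v ?w))
         + fst z \<bullet> (case (v, M) of (v, X) \<Rightarrow> matrix_inv X *v v))))) (at (v, M))"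
    by (intro has_derivative_mult_right has_derivative_add has_derivative_diff has_derivative_const l q)
  also have "(\<lambda>z. 1/2 * (real CARD('n) * ln pi - ln (det (snd z))
       + 1/2 * (fst z \<bullet> (case z of (v, X) \<Rightarrow> matrix_inv X *v v)))) = (F_N :: (real^'n) \<times> (real^'n^'n) \<Rightarrow> real)"
    by (auto simp: F_N_def fun_eq_iff)
  also have "(\<lambda>z. 1/2 * (0 - trace (matrix_inv M ** snd z)
       + 1/2 * (fst (v, M) \<bullet> (case z of (h, H) \<Rightarrow> matrix_inv M *v (h - H *v ?w))
         + fst z \<bullet> (case (v, M) of (v, X) \<Rightarrow> matrix_inv X *v v)))) = (\<lambda>h. grad_N (v, M) \<bullet> h)"
  proof
    fix z :: "(real^'n) \<times> (real^'n^'n)"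
    obtain h H where z: "z = (h, H)" by force
    have sym: "transpose (matrix_inv M) = matrix_inv M" by (rule sym_matrix_inv[OF M])
    have 1: "v \<bullet> (matrix_inv M *v u) = ?w \<bullet> u" for u
      by (metis sym inner_matvec_transpose)
    have "trace (matrix_inv M ** H) = trace (H ** matrix_inv M)" by (rule trace_mul_sym)
    also have "\<dots> = matrix_inv M \<bullet> H" by (simp add: trace_mult_eq_inner sym inner_commute)
    finally have 2: "trace (matrix_inv M ** H) = matrix_inv M \<bullet> H" .
    have 3: "outer ?w ?w \<bullet> H = ?w \<bullet> (H *v ?w)" by (simp add: inner_outer inner_commute)
    show "1/2 * (0 - trace (matrix_inv M ** snd z)
       + 1/2 * (fst (v, M) \<bullet> (case z of (h, H) \<Rightarrow> matrix_inv M *v (h - H *v ?w))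
         + fst z \<bullet> (case (v, M) of (v, X) \<Rightarrow> matrix_inv X *v v))) = grad_N (v, M) \<bullet> z"
      by (simp add: z 1 2 3 grad_N_def Let_def inner_diff_right inner_diff_left inner_minus_left
          inner_add_left inner_commute[of h] ring_distribs)
  qed
  finally show ?thesis .
qed

lemma sym_outer: "outer w w \<in> sym_matrices"
  by (simp add: sym_matrices_def transpose_outer)

lemma gradient_F_N:
  fixes \<theta> :: "(real^'n) \<times> (real^'n^'n)"
  assumes "\<theta> \<in> domain_N"
  shows "gradient_on space_N F_N \<theta> = grad_N \<theta>"
proof -
  obtain v M where \<theta>: "\<theta> = (v, M)" by (cases \<theta>)
  have M: "M \<in> spd_matrices" using assms by (simp add: \<theta>)
  have S: "matrix_inv M \<in> sym_matrices" using spd_matrix_inv[OF M] by (rule spd_imp_sym)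
  show ?thesis
  proof (rule gradient_on_eqI)
    show "subspace (space_N :: ((real^'n) \<times> (real^'n^'n)) set)"
      using subspace_Times[OF subspace_UNIV subspace_sym_matrices] .
    show "\<theta> \<in> space_N" using spd_imp_sym[OF M] by (simp add: \<theta>)
    have "- ((1/2) *\<^sub>R matrix_inv M + (1/4) *\<^sub>R outer w w) \<in> sym_matrices" for w
      using subspace_neg[OF subspace_sym_matrices subspace_add[OF subspace_sym_matrices
          subspace_scale[OF subspace_sym_matrices S] subspace_scale[OF subspace_sym_matrices sym_outer]]] .
    then show "grad_N \<theta> \<in> space_N"
      by (simp only: \<theta> grad_N_def Let_def prod.case mem_Times_iff fst_conv snd_conv UNIV_I simp_thms)
    show "(F_N has_derivative (\<lambda>h. grad_N \<theta> \<bullet> h)) (at \<theta> within space_N)"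
      unfolding \<theta> by (rule has_derivative_at_withinI[OF has_derivative_F_N[OF M]])
  qed
qed

text \<open>Chain rule along the inclusion of a matrix \<open>X\<close> as the pair
  \<open>(0, X)\<close>.\<close>

lemma gradient_F_P:
  fixes M :: "real^'n^'n"
  assumes M: "M \<in> spd_matrices"
  shows "gradient_on sym_matrices F_P M = - ((1/2) *\<^sub>R matrix_inv M)"
proof (rule gradient_on_eqI[OF subspace_sym_matrices spd_imp_sym[OF M]])
  show "- ((1/2) *\<^sub>R matrix_inv M) \<in> sym_matrices"
    using subspace_neg[OF subspace_sym_matrices subspace_scale[OF subspace_sym_matrices
        spd_imp_sym[OF spd_matrix_inv[OF M]]]] .
  have "((\<lambda>X :: real^'n^'n. (0 :: real^'n, X)) has_derivative (\<lambda>H. (0, H))) (at M within sym_matrices)"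
    by (auto intro!: derivative_eq_intros)
  from has_derivative_compose[OF this, of F_N] has_derivative_F_N[OF M, of 0]
  have "((\<lambda>X. F_N (0, X)) has_derivative (\<lambda>H. grad_N (0, M) \<bullet> (0, H))) (at M within sym_matrices)"
    by blast
  moreover have "grad_N (0, M) \<bullet> (0, H) = - ((1/2) *\<^sub>R matrix_inv M) \<bullet> H" for H
    by (simp add: grad_N_0)
  ultimately show "(F_P has_derivative (\<lambda>H. - ((1/2) *\<^sub>R matrix_inv M) \<bullet> H)) (at M within sym_matrices)"
    unfolding F_P_def[abs_def] by (simp only:)
qed

section \<open>Legendre conjugates and Fenchel-Young divergences\<close>

text \<open>The first component determines \<open>w\<close>, the second then determines
  \<open>matrix_inv M\<close> and so \<open>M\<close>, and finally \<open>v = M *v w\<close>. This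
  makes the description in \<open>legendre_conj\<close> denote the intended parameter.\<close>

lemma inj_on_grad_N: "inj_on grad_N domain_N"
proof (rule inj_onI)
  fix \<theta> \<theta>' :: "(real^'n) \<times> (real^'n^'n)"
  assume dom: "\<theta> \<in> domain_N" "\<theta>' \<in> domain_N" and eq: "grad_N \<theta> = grad_N \<theta>'"
  obtain v M v' M' where \<theta>: "\<theta> = (v, M)" "\<theta>' = (v', M')" by force
  have inv: "invertible M" "invertible M'" using dom by (auto simp: \<theta> spd_invertible)
  have w: "matrix_inv M *v v = matrix_inv M' *v v'"
    using eq by (simp add: \<theta> grad_N_def Let_def)
  then have "matrix_inv M = matrix_inv M'"
    using eq by (simp add: \<theta> grad_N_def Let_def)
  then have "M = M'" by (metis inv matrix_inv_inv)
  moreover from this w have "v = v'" by (metis inv(1) matrix_inv_vec(1))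
  ultimately show "\<theta> = \<theta>'" by (simp add: \<theta>)
qed

text \<open>By injectivity the conjugate at the gradient of \<open>\<theta>'\<close> is evaluated at
  \<open>\<theta>'\<close> itself; what remains is a rearrangement of the Bregman
  divergence.\<close>

lemma fenchel_young_eq_bregman:
  assumes "inj_on (gradient_on V F) \<Theta>" "\<theta>' \<in> \<Theta>"
  shows "fenchel_young_div \<Theta> V F \<theta> (gradient_on V F \<theta>') = bregman_div V F \<theta> \<theta>'"
proof -
  have "(THE \<theta>. \<theta> \<in> \<Theta> \<and> gradient_on V F \<theta> = gradient_on V F \<theta>') = \<theta>'"
    using assms by (auto intro!: the_equality dest: inj_onD)
  then show ?thesis
    by (simp add: fenchel_young_div_def legendre_conj_def bregman_div_def inner_diff_left)
qed

lemma fenchel_young_F_N: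
  assumes "\<theta>' \<in> domain_N"
  shows "fenchel_young_div domain_N space_N F_N \<theta> (gradient_on space_N F_N \<theta>') = bregman_div space_N F_N \<theta> \<theta>'"
proof (rule fenchel_young_eq_bregman[OF _ assms])
  show "inj_on (gradient_on space_N F_N) domain_N"
    by (rule inj_on_cong[THEN iffD2, OF gradient_F_N inj_on_grad_N])
qed

lemma fenchel_young_F_P:
  fixes M' :: "real^'n^'n"
  assumes "M' \<in> spd_matrices"
  shows "fenchel_young_div spd_matrices sym_matrices F_P M (gradient_on sym_matrices F_P M')
    = bregman_div sym_matrices F_P M M'"
proof (rule fenchel_young_eq_bregman[OF inj_onI assms])
  fix A B :: "real^'n^'n"
  assume A: "A \<in> spd_matrices" and B: "B \<in> spd_matrices"
    and "gradient_on sym_matrices F_P A = gradient_on sym_matrices F_P B"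
  then have "matrix_inv A = matrix_inv B" by (simp add: gradient_F_P)
  then show "A = B" by (metis A B matrix_inv_inv spd_invertible)
qed

section \<open>Closed form of the Bregman divergence\<close>

lemma natural_param_domain: "\<Sigma> \<in> spd_matrices \<Longrightarrow> natural_param \<mu> \<Sigma> \<in> domain_N"
  by (simp add: natural_param_def spd_scaleR spd_matrix_inv)

lemma matrix_inv_half_inv:
  "\<Sigma> \<in> spd_matrices \<Longrightarrow> matrix_inv ((1/2) *\<^sub>R matrix_inv \<Sigma>) = 2 *\<^sub>R \<Sigma>" for \<Sigma> :: "real^'n^'n"
  by (simp add: matrix_inv_scaleR invertible_matrix_inv spd_invertible matrix_inv_inv)

lemma grad_N_natural_param:
  assumes "\<Sigma> \<in> spd_matrices"
  shows "grad_N (natural_param \<mu> \<Sigma>) = (\<mu>, - (\<Sigma> + outer \<mu> \<mu>))"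
proof -
  have "matrix_inv ((1/2) *\<^sub>R matrix_inv \<Sigma>) *v (matrix_inv \<Sigma> *v \<mu>) = 2 *\<^sub>R \<mu>"
    using assms by (simp add: matrix_inv_half_inv matrix_inv_vec spd_invertible flip: scaleR_matrix_vector_assoc)
  moreover have "(1/4) *\<^sub>R outer (2 *\<^sub>R \<mu>) (2 *\<^sub>R \<mu>) = outer \<mu> \<mu>"
    by (simp add: outer_def vec_eq_iff)
  ultimately show ?thesis
    using assms by (simp add: grad_N_def natural_param_def Let_def matrix_inv_half_inv)
qed

lemma F_N_natural_param:
  fixes \<Sigma> :: "real^'n^'n"
  assumes "\<Sigma> \<in> spd_matrices"
  shows "F_N (natural_param \<mu> \<Sigma>)
    = 1/2 * (real CARD('n) * ln (2 * pi) + ln (det \<Sigma>) + \<mu> \<bullet> (matrix_inv \<Sigma> *v \<mu>))"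
proof -
  have pos: "det \<Sigma> > 0" by (rule spd_det_pos[OF assms])
  have "det ((1/2) *\<^sub>R matrix_inv \<Sigma>) = (1/2) ^ CARD('n) * (1 / det \<Sigma>)"
    using assms by (simp add: det_scaleR det_matrix_inv spd_invertible)
  then have "ln (det ((1/2) *\<^sub>R matrix_inv \<Sigma>)) = - (real CARD('n) * ln 2) - ln (det \<Sigma>)"
    using pos by (simp add: ln_mult_pos ln_realpow ln_div)
  moreover have "matrix_inv ((1/2) *\<^sub>R matrix_inv \<Sigma>) *v (matrix_inv \<Sigma> *v \<mu>) = 2 *\<^sub>R \<mu>"
    using assms by (simp add: matrix_inv_half_inv matrix_inv_vec spd_invertible flip: scaleR_matrix_vector_assoc)
  ultimately show ?thesis
    by (simp add: F_N_def natural_param_def ln_mult_pos inner_commute distrib_left)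
qed

lemma bregman_F_N:
  fixes \<Sigma>1 \<Sigma>2 :: "real^'n^'n"
  assumes S1: "\<Sigma>1 \<in> spd_matrices" and S2: "\<Sigma>2 \<in> spd_matrices"
  shows "bregman_div space_N F_N (natural_param \<mu>2 \<Sigma>2) (natural_param \<mu>1 \<Sigma>1) =
    1/2 * (ln (det \<Sigma>2) - ln (det \<Sigma>1) - real CARD('n) + matrix_inv \<Sigma>2 \<bullet> \<Sigma>1
      + (\<mu>1 - \<mu>2) \<bullet> (matrix_inv \<Sigma>2 *v (\<mu>1 - \<mu>2)))"
proof -
  \<comment> \<open>Kept general in \<open>\<mu>\<close> and \<open>\<Sigma>\<close>, since both
    parameters are paired with the gradient at the first one.\<close>
  have inner: "natural_param \<mu> \<Sigma> \<bullet> grad_N (natural_param \<mu>1 \<Sigma>1)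
      = (matrix_inv \<Sigma> *v \<mu>) \<bullet> \<mu>1 - 1/2 * (matrix_inv \<Sigma> \<bullet> \<Sigma>1) - 1/2 * (\<mu>1 \<bullet> (matrix_inv \<Sigma> *v \<mu>1))"
    for \<mu> \<Sigma>
    by (simp add: grad_N_natural_param S1) (simp add: natural_param_def inner_add_right inner_diff_right inner_minus_right
        inner_outer scaleR_matrix_vector_assoc [symmetric])
  have "matrix_inv \<Sigma>1 \<bullet> \<Sigma>1 = trace (matrix_inv \<Sigma>1 ** \<Sigma>1)"
    using S1 by (subst trace_mult_eq_inner) (simp_all add: spd_matrices_def)
  then have 1: "matrix_inv \<Sigma>1 \<bullet> \<Sigma>1 = real CARD('n)"
    using S1 by (simp add: matrix_inv_mult spd_invertible trace_I)
  have 2: "\<mu>2 \<bullet> (matrix_inv \<Sigma>2 *v \<mu>1) = (matrix_inv \<Sigma>2 *v \<mu>2) \<bullet> \<mu>1"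
    by (metis sym_matrix_inv[OF S2] inner_matvec_transpose)
  have 3: "(\<mu>1 - \<mu>2) \<bullet> (matrix_inv \<Sigma>2 *v (\<mu>1 - \<mu>2)) = \<mu>1 \<bullet> (matrix_inv \<Sigma>2 *v \<mu>1)
      - 2 * ((matrix_inv \<Sigma>2 *v \<mu>2) \<bullet> \<mu>1) + \<mu>2 \<bullet> (matrix_inv \<Sigma>2 *v \<mu>2)"
    by (simp add: matrix_vector_mult_diff_distrib inner_diff_left inner_diff_right 2
        inner_commute[of \<mu>1 "matrix_inv \<Sigma>2 *v \<mu>2"])
  have 4: "(matrix_inv \<Sigma>1 *v \<mu>1) \<bullet> \<mu>1 = \<mu>1 \<bullet> (matrix_inv \<Sigma>1 *v \<mu>1)"
    by (rule inner_commute)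
  show ?thesis
    unfolding bregman_div_def gradient_F_N[OF natural_param_domain[OF S1]] inner_diff_left[of "natural_param \<mu>2 \<Sigma>2"] inner
      F_N_natural_param[OF S1] F_N_natural_param[OF S2] 1 3 4
    by (simp add: algebra_simps)
qed

text \<open>With zero vector parts the vector component of the inner product vanishes, so
  \<open>bregman_F_N\<close> with zero means covers the centered case.\<close>

lemma bregman_F_P:
  fixes A B :: "real^'n^'n"
  assumes "B \<in> spd_matrices"
  shows "bregman_div sym_matrices F_P A B = bregman_div space_N F_N (0, A) (0, B)"
proof -
  have "(0, B) \<in> domain_N" using assms by simp
  then show ?thesis
    unfolding bregman_div_def gradient_F_P[OF assms] by (simp only: gradient_F_N grad_N_0 F_P_def) simp
qed

section \<open>The block embedding\<close>

text \<open>General block matrices with a last row \<open>c\<close> and a last column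
  \<open>b\<close>. Unlike the image of \<open>block_embed\<close>, they are closed under products
  and contain triangular factors.\<close>

definition bordered :: "real^'n^'n \<Rightarrow> real^'n \<Rightarrow> real^'n \<Rightarrow> real \<Rightarrow> real^('n::finite option)^('n option)" where
  "bordered A b c d = (\<chi> i j. case (i, j) of
     (Some k, Some l) \<Rightarrow> A $ k $ l | (Some k, None) \<Rightarrow> b $ k
   | (None, Some l) \<Rightarrow> c $ l | (None, None) \<Rightarrow> d)"

lemma bordered_nth [simp]:
  "bordered A b c d $ Some k $ Some l = A $ k $ l" "bordered A b c d $ Some k $ None = b $ k"
  "bordered A b c d $ None $ Some l = c $ l" "bordered A b c d $ None $ None = d"
  by (simp_all add: bordered_def)

lemma sum_UNIV_option: "(\<Sum>i\<in>UNIV. f i) = f None + (\<Sum>a\<in>UNIV. f (Some a))"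
  for f :: "'a::finite option \<Rightarrow> real"
  by (simp add: UNIV_option_conv sum.reindex)

lemma prod_UNIV_option: "(\<Prod>i\<in>UNIV. f i) = f None * (\<Prod>a\<in>UNIV. f (Some a))"
  for f :: "'a::finite option \<Rightarrow> real"
  by (simp add: UNIV_option_conv prod.reindex)

lemma forall_option: "(\<forall>i. P i) \<longleftrightarrow> P None \<and> (\<forall>a. P (Some a))"
  by (metis option.exhaust)

lemma bordered_mult:
  "bordered A b c d ** bordered A' b' c' d'
    = bordered (A ** A' + outer b c') (A *v b' + d' *\<^sub>R b) (transpose A' *v c + d *\<^sub>R c') (c \<bullet> b' + d * d')"
  unfolding vec_eq_iff forall_option
  by (simp add: matrix_matrix_mult_def matrix_vector_mult_def sum_UNIV_option outer_def inner_vec_def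
      vector_matrix_mult_def transpose_def mult.commute add.commute)

lemma mat_1_bordered: "mat 1 = bordered (mat 1) 0 0 1"
  unfolding vec_eq_iff forall_option by (simp add: mat_def)

lemma transpose_bordered: "transpose (bordered A b c d) = bordered (transpose A) c b d"
  unfolding vec_eq_iff forall_option by (simp add: transpose_def)

lemma inner_bordered:
  "bordered A b c d \<bullet> bordered A' b' c' d' = A \<bullet> A' + b \<bullet> b' + c \<bullet> c' + d * d'"
  by (simp add: inner_vec_def sum_UNIV_option sum.distrib)

text \<open>In the Leibniz sum, a permutation moving \<open>None\<close> picks a zero from the last
  row; those fixing \<open>None\<close> are the permutations of the original index type, with the
  same sign.\<close>

lemma det_bordered_lower: "det (bordered A b 0 1) = det A"
proof -
  let ?M = "bordered A b 0 1"
  let ?t = "\<lambda>p. of_int (sign p) * (\<Prod>i\<in>UNIV. ?M $ i $ p i)"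
  have bij: "bij_betw Some UNIV (range Some)" "bij_betw the (range Some) (UNIV :: 'a set)"
    by (auto simp: bij_betw_def inj_on_def image_image)
  have perm: "p permutes range Some" if p: "p permutes (UNIV :: 'a option set)" and "p None = None" for p
    using p \<open>p None = None\<close> by (auto simp: permutes_def) (metis option.exhaust range_eqI)
  have "det ?M = (\<Sum>p | p permutes UNIV. ?t p)"
    by (simp add: det_def)
  also have "\<dots> = (\<Sum>p | p permutes range Some. ?t p)"
  proof (rule sum.mono_neutral_right)
    show "{p. p permutes range Some} \<subseteq> {p. p permutes (UNIV :: 'a option set)}"
      by (auto intro: permutes_subset)
    show "\<forall>p\<in>{p. p permutes (UNIV :: 'a option set)} - {p. p permutes range Some}. ?t p = 0"
    proof
      fix p :: "'a option \<Rightarrow> 'a option"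
      assume "p \<in> {p. p permutes UNIV} - {p. p permutes range Some}"
      then have "p None \<noteq> None" using perm by blast
      then obtain a where "p None = Some a" by auto
      then show "?t p = 0" by (simp add: prod_UNIV_option)
    qed
  qed simp
  also have "\<dots> = (\<Sum>q | q permutes UNIV. of_int (sign q) * (\<Prod>a\<in>UNIV. A $ a $ q a))"
  \<comment> \<open>Permutations are transported along \<open>Some\<close> and back along
    \<open>the\<close>, which inverts it on \<open>range Some\<close>.\<close>
  proof (rule sum.reindex_bij_witness[where i = "map_permutation UNIV Some" and j = "map_permutation (range Some) the"])
    fix p :: "'a option \<Rightarrow> 'a option"
    assume "p \<in> {p. p permutes range Some}"
    then have p: "p permutes range Some" by simp
    show eq: "map_permutation UNIV Some (map_permutation (range Some) the p) = p"
      by (rule map_permutation_compose_inv[OF bij(2) p]) auto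
    show q: "map_permutation (range Some) the p \<in> {q. q permutes UNIV}"
      using map_permutation_permutes[OF bij(2) p] by simp
    define q where "q = map_permutation (range Some) the p"
    have q: "q permutes UNIV" "p = map_permutation UNIV Some q"
      using q eq by (simp_all add: q_def)
    have "p (Some a) = Some (q a)" for a
      by (simp add: q(2) map_permutation_apply)
    moreover have "p None = None" using p by (auto simp: permutes_def)
    moreover have "sign p = sign q"
      using sign_map_permutation[of Some UNIV q] q by simp
    ultimately show "of_int (sign (map_permutation (range Some) the p))
        * (\<Prod>a\<in>UNIV. A $ a $ map_permutation (range Some) the p a) = ?t p"
      by (simp add: prod_UNIV_option flip: q_def)
  next
    fix q :: "'a \<Rightarrow> 'a"
    assume "q \<in> {q. q permutes UNIV}"
    then have q: "q permutes UNIV" by simp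
    show "map_permutation (range Some) the (map_permutation UNIV Some q) = q"
      by (rule map_permutation_compose_inv[OF bij(1) q]) auto
    show "map_permutation UNIV Some q \<in> {p. p permutes range Some}"
      using map_permutation_permutes[OF bij(1) q] by simp
  qed
  also have "\<dots> = det A" by (simp add: det_def)
  finally show ?thesis .
qed

lemma block_embed_bordered: "block_embed \<mu> \<Sigma> = bordered (\<Sigma> + outer \<mu> \<mu>) \<mu> \<mu> 1"
  unfolding vec_eq_iff forall_option by (simp add: block_embed_def outer_def)

text \<open>The embedded matrix is a product of two block-triangular matrices with determinants 1
  and \<open>det \<Sigma>\<close>.\<close>

lemma det_block_embed: "det (block_embed \<mu> \<Sigma>) = det \<Sigma>"
proof -
  have "block_embed \<mu> \<Sigma> = bordered (mat 1) \<mu> 0 1 ** bordered \<Sigma> 0 \<mu> 1"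
    by (simp add: block_embed_bordered bordered_mult del: transpose_matrix_vector)
  moreover have "det (bordered \<Sigma> 0 \<mu> 1) = det \<Sigma>"
    by (metis det_bordered_lower det_transpose transpose_bordered)
  ultimately show ?thesis by (simp add: det_mul det_bordered_lower)
qed

lemma spd_mult_transpose:
  fixes R :: "real^'n^'n"
  assumes "invertible R"
  shows "R ** transpose R \<in> spd_matrices"
proof -
  have "transpose R *v x \<noteq> 0" if "x \<noteq> 0" for x
  proof
    assume "transpose R *v x = 0"
    moreover have "invertible (transpose R)" using assms by (simp add: invertible_det_nz)
    ultimately show False using that by (metis matrix_inv_vec(2) matrix_vector_mult_0_right)
  qed
  moreover have "x \<bullet> ((R ** transpose R) *v x) = (transpose R *v x) \<bullet> (transpose R *v x)" for x
    by (metis inner_matvec_transpose matrix_vector_mul_assoc)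
  ultimately show ?thesis
    by (simp add: spd_matrices_def matrix_transpose_mul del: transpose_matrix_vector)
qed

text \<open>A factor \<open>A\<close> of \<open>\<Sigma>\<close> extends to the factor
  \<open>bordered A \<mu> 0 1\<close> of the embedded matrix.\<close>

lemma block_embed_spd:
  fixes \<Sigma> :: "real^'n^'n"
  assumes "\<Sigma> \<in> spd_matrices"
  shows "block_embed \<mu> \<Sigma> \<in> spd_matrices"
proof -
  obtain A :: "real^'n^'n" where A: "invertible A" "\<Sigma> = A ** transpose A"
    using spd_factorization[OF assms] by blast
  have "invertible (bordered A \<mu> 0 1)"
    using A(1) by (simp add: invertible_det_nz det_bordered_lower)
  moreover have "bordered A \<mu> 0 1 ** transpose (bordered A \<mu> 0 1) = block_embed \<mu> \<Sigma>"
    by (simp add: block_embed_bordered A(2) transpose_bordered bordered_mult del: transpose_matrix_vector)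
  ultimately show ?thesis using spd_mult_transpose by metis
qed

lemma matrix_matrix_mult_add_rdistrib: "(A + B) ** C = A ** C + B ** C" for A B :: "real^'n^'m"
  by (simp add: matrix_matrix_mult_def vec_eq_iff distrib_right sum.distrib)

text \<open>The Schur complement of the corner entry 1 is \<open>\<Sigma>\<close>, whence the block
  \<open>S\<close>; the product with the proposed inverse is checked blockwise.\<close>

lemma matrix_inv_block_embed:
  assumes "\<Sigma> \<in> spd_matrices"
  defines "S \<equiv> matrix_inv \<Sigma>"
  shows "matrix_inv (block_embed \<mu> \<Sigma>) = bordered S (- (S *v \<mu>)) (- (S *v \<mu>)) (1 + \<mu> \<bullet> (S *v \<mu>))"
proof (rule matrix_inv_unique(1))
  have inv: "invertible \<Sigma>" using assms(1) by (rule spd_invertible)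
  have S: "\<Sigma> ** S = mat 1" "transpose S = S" "\<Sigma> *v (S *v x) = x" for x
    using matrix_inv_mult[OF inv] sym_matrix_inv[OF assms(1)] matrix_inv_vec[OF inv] by (simp_all add: S_def)
  have neg: "A *v (- x) = - (A *v x)" for A :: "real^'a^'a" and x
    by (simp add: vec_eq_iff matrix_vector_mult_def sum_negf)
  have outer: "outer \<mu> \<mu> ** S = outer \<mu> (S *v \<mu>)"
  proof -
    have "outer \<mu> \<mu> ** S = outer \<mu> (transpose S *v \<mu>)"
      by (simp add: vec_eq_iff outer_def matrix_matrix_mult_def vector_matrix_mult_def sum_distrib_left mult_ac)
    then show ?thesis by (simp only: S)
  qed
  have "outer v (- w) = - outer v w" for v w :: "real^'a"
    by (simp add: vec_eq_iff outer_def)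
  then show "block_embed \<mu> \<Sigma> ** bordered S (- (S *v \<mu>)) (- (S *v \<mu>)) (1 + \<mu> \<bullet> (S *v \<mu>)) = mat 1"
    by (simp add: block_embed_bordered bordered_mult S mat_1_bordered matrix_matrix_mult_add_rdistrib outer neg
        matrix_vector_mult_add_rdistrib outer_mult_vec algebra_simps del: transpose_matrix_vector)
qed

text \<open>The border entries of the inverse supply the cross terms and the \<open>\<mu>2\<close>
  term that complete the square in \<open>\<mu>1 - \<mu>2\<close>. The extra 1 comes from the
  corner.\<close>

lemma inner_block_embed:
  assumes "\<Sigma>2 \<in> spd_matrices"
  shows "matrix_inv (block_embed \<mu>2 \<Sigma>2) \<bullet> block_embed \<mu>1 \<Sigma>1
    = matrix_inv \<Sigma>2 \<bullet> \<Sigma>1 + (\<mu>1 - \<mu>2) \<bullet> (matrix_inv \<Sigma>2 *v (\<mu>1 - \<mu>2)) + 1"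
proof -
  let ?S = "matrix_inv \<Sigma>2"
  have "\<mu>2 \<bullet> (?S *v \<mu>1) = (?S *v \<mu>2) \<bullet> \<mu>1" "\<mu>1 \<bullet> (?S *v \<mu>2) = (?S *v \<mu>2) \<bullet> \<mu>1"
    using inner_matvec_transpose[of \<mu>2 ?S \<mu>1] sym_matrix_inv[OF assms] by (simp_all add: inner_commute)
  then show ?thesis
    unfolding matrix_inv_block_embed[OF assms]
    by (simp add: block_embed_bordered inner_bordered inner_add_right inner_outer
        matrix_vector_mult_diff_distrib inner_diff_left inner_diff_right)
qed

section \<open>The chain of equalities\<close>

theorem proposition4:
  fixes \<mu>1 \<mu>2 :: "real^'n::finite" and \<Sigma>1 \<Sigma>2 :: "real^'n^'n"
    and \<theta>1 \<theta>2 \<eta>1 \<eta>2 :: "(real^'n) \<times> (real^'n^'n)"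
    and P1 P2 \<theta>bar1 \<theta>bar2 \<eta>bar1 \<eta>bar2 :: "real^('n option)^('n option)"
  assumes "\<Sigma>1 \<in> spd_matrices" and "\<Sigma>2 \<in> spd_matrices"
    and "\<theta>1 = natural_param \<mu>1 \<Sigma>1" and "\<theta>2 = natural_param \<mu>2 \<Sigma>2"
    and "\<eta>1 = gradient_on space_N F_N \<theta>1" and "\<eta>2 = gradient_on space_N F_N \<theta>2"
    and "P1 = block_embed \<mu>1 \<Sigma>1" and "P2 = block_embed \<mu>2 \<Sigma>2"
    and "\<theta>bar1 = (1/2) *\<^sub>R matrix_inv P1" and "\<theta>bar2 = (1/2) *\<^sub>R matrix_inv P2"
    and "\<eta>bar1 = gradient_on sym_matrices F_P \<theta>bar1"
    and "\<eta>bar2 = gradient_on sym_matrices F_P \<theta>bar2"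
  shows
    "kl_div (mvn_density \<mu>1 \<Sigma>1) (mvn_density \<mu>2 \<Sigma>2) = bregman_div space_N F_N \<theta>2 \<theta>1
     \<and> bregman_div space_N F_N \<theta>2 \<theta>1 = fenchel_young_div domain_N space_N F_N \<theta>2 \<eta>1
     \<and> fenchel_young_div domain_N space_N F_N \<theta>2 \<eta>1
         = fenchel_young_div spd_matrices sym_matrices F_P \<theta>bar2 \<eta>bar1
     \<and> fenchel_young_div spd_matrices sym_matrices F_P \<theta>bar2 \<eta>bar1
         = bregman_div sym_matrices F_P \<theta>bar2 \<theta>bar1
     \<and> bregman_div sym_matrices F_P \<theta>bar2 \<theta>bar1
         = kl_div (mvn_density 0 P1) (mvn_density 0 P2)"
proof -
  have P: "P1 \<in> spd_matrices" "P2 \<in> spd_matrices"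
    using assms block_embed_spd by auto
  have \<theta>bar: "natural_param 0 P1 = (0, \<theta>bar1)" "natural_param 0 P2 = (0, \<theta>bar2)"
    by (simp_all add: natural_param_def assms)
  have \<theta>bar1: "\<theta>bar1 \<in> spd_matrices"
    using assms P by (simp add: spd_scaleR spd_matrix_inv)
  have "kl_div (mvn_density \<mu>1 \<Sigma>1) (mvn_density \<mu>2 \<Sigma>2) = bregman_div space_N F_N \<theta>2 \<theta>1"
    using assms by (simp only: kl_div_mvn bregman_F_N)
  moreover have "fenchel_young_div domain_N space_N F_N \<theta>2 \<eta>1 = bregman_div space_N F_N \<theta>2 \<theta>1"
    using assms by (simp only: fenchel_young_F_N natural_param_domain)
  moreover have "fenchel_young_div spd_matrices sym_matrices F_P \<theta>bar2 \<eta>bar1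
      = bregman_div sym_matrices F_P \<theta>bar2 \<theta>bar1"
    unfolding \<open>\<eta>bar1 = _\<close> by (rule fenchel_young_F_P[OF \<theta>bar1])
  moreover have bregman_P: "bregman_div sym_matrices F_P \<theta>bar2 \<theta>bar1
      = kl_div (mvn_density 0 P1) (mvn_density 0 P2)"
    using bregman_F_N[OF P, of 0 0] kl_div_mvn[OF P, of 0 0]
    by (simp only: bregman_F_P[OF \<theta>bar1] \<theta>bar)
  \<comment> \<open>The link between the two families: in the closed forms, the 1 from
    \<open>inner_block_embed\<close> cancels the increase of the dimension from \<open>d\<close> to
    \<open>d + 1\<close>.\<close>
  moreover have "kl_div (mvn_density \<mu>1 \<Sigma>1) (mvn_density \<mu>2 \<Sigma>2)
      = kl_div (mvn_density 0 P1) (mvn_density 0 P2)"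
    unfolding kl_div_mvn[OF assms(1,2)] kl_div_mvn[OF P]
    by (simp add: \<open>P1 = _\<close> \<open>P2 = _\<close> det_block_embed inner_block_embed[OF assms(2)])
  ultimately show ?thesis by simp
qed

end
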